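(* Let $p,q,r$ be distinct primes and let $G=C_p*C_q*C_r$. Then $G$ has infinitely many proper normal finite index subgroups and is equal to the union of all of them, but $G$ is not the union of any finite collection of proper normal finite index subgroups of $G$.
   Context: $C_m$ denotes the cyclic group of order $m$, and $*$ denotes the free product of groups. *)

theory Defs
  imports "HOL-Algebra.Elementary_Groups" "HOL-Computational_Algebra.Primes"
begin

text \<open>The free product of the groups \<open>G i\<close> (\<open>i \<in> I\<close>): words over the disjoint union of the
  carriers, modulo the smallest congruence of the word monoid that identifies the one-letter word of
  each unit with the empty word and multiplies adjacent letters coming from the same factor.\<close>

definition fp_words :: "'i set \<Rightarrow> ('i \<Rightarrow> ('a, 'm) monoid_scheme) \<Rightarrow> ('i \<times> 'a) list set" where
  "fp_words I G = lists (SIGMA i:I. carrier (G i))"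

inductive fp_eq :: "'i set \<Rightarrow> ('i \<Rightarrow> ('a, 'm) monoid_scheme) \<Rightarrow> ('i \<times> 'a) list \<Rightarrow> ('i \<times> 'a) list \<Rightarrow> bool"
  for I G where
  refl: "u \<in> fp_words I G \<Longrightarrow> fp_eq I G u u"
| sym: "fp_eq I G u v \<Longrightarrow> fp_eq I G v u"
| trans: "fp_eq I G u v \<Longrightarrow> fp_eq I G v w \<Longrightarrow> fp_eq I G u w"
| one: "u \<in> fp_words I G \<Longrightarrow> v \<in> fp_words I G \<Longrightarrow> i \<in> I \<Longrightarrow>
    fp_eq I G (u @ [(i, \<one>\<^bsub>G i\<^esub>)] @ v) (u @ v)"
| mult: "u \<in> fp_words I G \<Longrightarrow> v \<in> fp_words I G \<Longrightarrow> i \<in> I \<Longrightarrow>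
    a \<in> carrier (G i) \<Longrightarrow> b \<in> carrier (G i) \<Longrightarrow>
    fp_eq I G (u @ [(i, a), (i, b)] @ v) (u @ [(i, a \<otimes>\<^bsub>G i\<^esub> b)] @ v)"

definition fp_rel :: "'i set \<Rightarrow> ('i \<Rightarrow> ('a, 'm) monoid_scheme) \<Rightarrow> ('i \<times> 'a) list rel" where
  "fp_rel I G = {(u, v). fp_eq I G u v}"

definition free_product :: "'i set \<Rightarrow> ('i \<Rightarrow> ('a, 'm) monoid_scheme) \<Rightarrow> ('i \<times> 'a) list set monoid" where
  "free_product I G =
    \<lparr>carrier = fp_words I G // fp_rel I G,
     monoid.mult = (\<lambda>A B. \<Union>u\<in>A. \<Union>v\<in>B. fp_rel I G `` {u @ v}),
     one = fp_rel I G `` {[]}\<rparr>"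

definition fp_incl :: "'i set \<Rightarrow> ('i \<Rightarrow> ('a, 'm) monoid_scheme) \<Rightarrow> 'i \<Rightarrow> 'a \<Rightarrow> ('i \<times> 'a) list set" where
  "fp_incl I G i a = fp_rel I G `` {[(i, a)]}"

definition proper_normal_finite_index_subgroups :: "('a, 'm) monoid_scheme \<Rightarrow> 'a set set" where
  "proper_normal_finite_index_subgroups G =
    {N. N \<lhd> G \<and> N \<noteq> carrier G \<and> finite (rcosets\<^bsub>G\<^esub> N)}"

text \<open>The construction is a group with the universal property of the coproduct.\<close>

lemma fp_words_simps [simp]:
  "[] \<in> fp_words I G"
  "x # u \<in> fp_words I G \<longleftrightarrow> fst x \<in> I \<and> snd x \<in> carrier (G (fst x)) \<and> u \<in> fp_words I G"
  "u @ v \<in> fp_words I G \<longleftrightarrow> u \<in> fp_words I G \<and> v \<in> fp_words I G"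
  by (cases x; auto simp: fp_words_def)+

context
  fixes I :: "'i set" and G :: "'i \<Rightarrow> ('a, 'm) monoid_scheme"
  assumes grp: "\<And>i. i \<in> I \<Longrightarrow> group (G i)"
begin

lemma fp_eq_words: "fp_eq I G u v \<Longrightarrow> u \<in> fp_words I G \<and> v \<in> fp_words I G"
proof (induction rule: fp_eq.induct)
  case (one u v i)
  then interpret group "G i" using grp by blast
  show ?case using one by simp
next
  case (mult u v i a b)
  then interpret group "G i" using grp by blast
  show ?case using mult by simp
qed auto

lemma fp_equiv: "equiv (fp_words I G) (fp_rel I G)"
  unfolding equiv_def refl_on_def sym_def trans_def fp_rel_def
  using fp_eq_words by (auto intro: fp_eq.refl fp_eq.sym fp_eq.trans)

lemma fp_eq_appl: "fp_eq I G u v \<Longrightarrow> w \<in> fp_words I G \<Longrightarrow> fp_eq I G (w @ u) (w @ v)"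
proof (induction rule: fp_eq.induct)
  case (one u v i)
  then show ?case using fp_eq.one[of "w @ u" I G v i] by simp
next
  case (mult u v i a b)
  then show ?case using fp_eq.mult[of "w @ u" I G v i a b] by simp
qed (auto intro: fp_eq.refl fp_eq.sym fp_eq.trans)

lemma fp_eq_appr: "fp_eq I G u v \<Longrightarrow> w \<in> fp_words I G \<Longrightarrow> fp_eq I G (u @ w) (v @ w)"
proof (induction rule: fp_eq.induct)
  case (one u v i)
  then show ?case using fp_eq.one[of u I G "v @ w" i] by simp
next
  case (mult u v i a b)
  then show ?case using fp_eq.mult[of u I G "v @ w" i a b] by simp
qed (auto intro: fp_eq.refl fp_eq.sym fp_eq.trans)

lemma fp_eq_app: "fp_eq I G u u' \<Longrightarrow> fp_eq I G v v' \<Longrightarrow> fp_eq I G (u @ v) (u' @ v')"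
  by (meson fp_eq_appl fp_eq_appr fp_eq_words fp_eq.trans)

lemma fp_class_eq:
  assumes "u \<in> fp_words I G" "v \<in> fp_words I G"
  shows "fp_rel I G `` {u} = fp_rel I G `` {v} \<longleftrightarrow> fp_eq I G u v"
  using eq_equiv_class_iff[OF fp_equiv assms] by (simp add: fp_rel_def)

lemma fp_mult:
  assumes "u \<in> fp_words I G" "v \<in> fp_words I G"
  shows "(fp_rel I G `` {u}) \<otimes>\<^bsub>free_product I G\<^esub> (fp_rel I G `` {v}) = fp_rel I G `` {u @ v}"
proof -
  have "congruent2 (fp_rel I G) (fp_rel I G) (\<lambda>u v. fp_rel I G `` {u @ v})"
  proof (rule congruent2I')
    fix u u' v v' assume "(u, u') \<in> fp_rel I G" "(v, v') \<in> fp_rel I G"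
    then have *: "fp_eq I G (u @ v) (u' @ v')" by (simp add: fp_rel_def fp_eq_app)
    then show "fp_rel I G `` {u @ v} = fp_rel I G `` {u' @ v'}"
      using fp_class_eq fp_eq_words[OF *] by blast
  qed
  from UN_equiv_class2[OF fp_equiv fp_equiv this assms] show ?thesis
    by (simp add: free_product_def)
qed

lemma fp_carrierE:
  assumes "x \<in> carrier (free_product I G)"
  obtains u where "u \<in> fp_words I G" "x = fp_rel I G `` {u}"
  using assms by (auto simp: free_product_def elim: quotientE)

lemma fp_carrierI: "u \<in> fp_words I G \<Longrightarrow> fp_rel I G `` {u} \<in> carrier (free_product I G)"
  by (auto simp: free_product_def intro: quotientI)

lemma fp_one: "\<one>\<^bsub>free_product I G\<^esub> = fp_rel I G `` {[]}"
  by (simp add: free_product_def)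

lemma fp_left_inverse:
  "u \<in> fp_words I G \<Longrightarrow> \<exists>v \<in> fp_words I G. fp_eq I G (v @ u) []"
proof (induction u)
  case Nil
  then show ?case by (auto intro!: bexI[of _ "[]"] fp_eq.refl)
next
  case (Cons x u)
  obtain i a where x: "x = (i, a)" by force
  have ia: "i \<in> I" "a \<in> carrier (G i)" "u \<in> fp_words I G" using Cons.prems x by auto
  interpret group "G i" using grp ia by blast
  obtain v where v: "v \<in> fp_words I G" "fp_eq I G (v @ u) []" using Cons ia by blast
  have "fp_eq I G (v @ [(i, inv\<^bsub>G i\<^esub> a), (i, a)] @ u) (v @ [(i, \<one>\<^bsub>G i\<^esub>)] @ u)"
    using fp_eq.mult[of v I G u i "inv\<^bsub>G i\<^esub> a" a] ia v by simp
  moreover have "fp_eq I G (v @ [(i, \<one>\<^bsub>G i\<^esub>)] @ u) (v @ u)"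
    using fp_eq.one[of v I G u i] ia v by simp
  ultimately have "fp_eq I G ((v @ [(i, inv\<^bsub>G i\<^esub> a)]) @ x # u) []"
    using v(2) by (simp add: x) (blast intro: fp_eq.trans)
  then show ?case using v ia by (intro bexI[of _ "v @ [(i, inv\<^bsub>G i\<^esub> a)]"]) auto
qed

lemma group_free_product: "group (free_product I G)"
proof (rule groupI)
  fix x y assume "x \<in> carrier (free_product I G)" "y \<in> carrier (free_product I G)"
  then show "x \<otimes>\<^bsub>free_product I G\<^esub> y \<in> carrier (free_product I G)"
    by (auto elim!: fp_carrierE simp: fp_mult intro!: fp_carrierI)
next
  show "\<one>\<^bsub>free_product I G\<^esub> \<in> carrier (free_product I G)"
    by (simp add: fp_one fp_carrierI)
next
  fix x y z
  assume "x \<in> carrier (free_product I G)" "y \<in> carrier (free_product I G)"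
    "z \<in> carrier (free_product I G)"
  then show "x \<otimes>\<^bsub>free_product I G\<^esub> y \<otimes>\<^bsub>free_product I G\<^esub> z =
      x \<otimes>\<^bsub>free_product I G\<^esub> (y \<otimes>\<^bsub>free_product I G\<^esub> z)"
    by (auto elim!: fp_carrierE simp: fp_mult)
next
  fix x assume "x \<in> carrier (free_product I G)"
  then show "\<one>\<^bsub>free_product I G\<^esub> \<otimes>\<^bsub>free_product I G\<^esub> x = x"
    by (auto elim!: fp_carrierE simp: fp_mult fp_one)
next
  fix x assume "x \<in> carrier (free_product I G)"
  then obtain u where u: "u \<in> fp_words I G" "x = fp_rel I G `` {u}" by (rule fp_carrierE)
  obtain v where v: "v \<in> fp_words I G" "fp_eq I G (v @ u) []" using fp_left_inverse u by blast
  show "\<exists>y\<in>carrier (free_product I G). y \<otimes>\<^bsub>free_product I G\<^esub> x = \<one>\<^bsub>free_product I G\<^esub>"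
    using u v by (intro bexI[of _ "fp_rel I G `` {v}"])
      (auto simp: fp_mult fp_one fp_class_eq intro!: fp_carrierI)
qed

lemma fp_incl_hom:
  assumes i: "i \<in> I"
  shows "fp_incl I G i \<in> hom (G i) (free_product I G)"
proof -
  interpret group "G i" using grp i by blast
  show ?thesis
  proof (rule homI)
    fix a assume "a \<in> carrier (G i)"
    then show "fp_incl I G i a \<in> carrier (free_product I G)"
      using i by (simp add: fp_incl_def fp_carrierI)
  next
    fix a b assume ab: "a \<in> carrier (G i)" "b \<in> carrier (G i)"
    have "fp_eq I G [(i, a \<otimes>\<^bsub>G i\<^esub> b)] [(i, a), (i, b)]"
      using fp_eq.sym[OF fp_eq.mult[of "[]" I G "[]" i a b]] i ab by simp
    then show "fp_incl I G i (a \<otimes>\<^bsub>G i\<^esub> b) =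
        fp_incl I G i a \<otimes>\<^bsub>free_product I G\<^esub> fp_incl I G i b"
      using i ab by (simp add: fp_incl_def fp_mult fp_class_eq)
  qed
qed

lemma free_product_universal:
  assumes H: "group H" and f: "\<And>i. i \<in> I \<Longrightarrow> f i \<in> hom (G i) H"
  shows "\<exists>h \<in> hom (free_product I G) H. \<forall>i\<in>I. \<forall>a\<in>carrier (G i). h (fp_incl I G i a) = f i a"
proof -
  interpret H: group H by fact
  define e where "e u = foldr (\<lambda>(i, a) y. f i a \<otimes>\<^bsub>H\<^esub> y) u \<one>\<^bsub>H\<^esub>" for u
  have e_simps: "e [] = \<one>\<^bsub>H\<^esub>" "e ((i, a) # u) = f i a \<otimes>\<^bsub>H\<^esub> e u" for i a u
    by (simp_all add: e_def)
  have fc: "f i a \<in> carrier H" if "i \<in> I" "a \<in> carrier (G i)" for i a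
    using f[OF that(1)] that(2) by (rule hom_in_carrier)
  have ec: "e u \<in> carrier H" if "u \<in> fp_words I G" for u
    using that by (induction u) (auto simp: e_simps fc)
  have eapp: "e (u @ v) = e u \<otimes>\<^bsub>H\<^esub> e v" if "u \<in> fp_words I G" "v \<in> fp_words I G" for u v
    using that by (induction u) (auto simp: e_simps fc ec H.m_assoc)
  have eeq: "e u = e v" if "fp_eq I G u v" for u v
    using that
  proof (induction rule: fp_eq.induct)
    case (one u v i)
    interpret Gi: group "G i" using grp one by blast
    have "f i \<one>\<^bsub>G i\<^esub> = \<one>\<^bsub>H\<^esub>" using hom_one[OF f Gi.is_group H] one by blast
    then show ?case using one by (simp add: eapp e_simps ec)
  next
    case (mult u v i a b)
    interpret Gi: group "G i" using grp mult by blast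
    have "f i (a \<otimes>\<^bsub>G i\<^esub> b) = f i a \<otimes>\<^bsub>H\<^esub> f i b" using hom_mult[OF f] mult by blast
    then show ?case using mult by (simp add: eapp e_simps ec fc H.m_assoc)
  qed auto
  define h where "h A = e (SOME u. u \<in> A)" for A
  have hcl: "h (fp_rel I G `` {u}) = e u" if "u \<in> fp_words I G" for u
  proof -
    have "u \<in> fp_rel I G `` {u}" using that by (simp add: fp_rel_def fp_eq.refl)
    then have "(SOME v. v \<in> fp_rel I G `` {u}) \<in> fp_rel I G `` {u}" by (rule someI)
    then show ?thesis by (simp add: h_def fp_rel_def eeq)
  qed
  have "h \<in> hom (free_product I G) H"
    by (rule homI) (auto elim!: fp_carrierE simp: fp_mult hcl ec eapp)
  moreover have "h (fp_incl I G i a) = f i a" if "i \<in> I" "a \<in> carrier (G i)" for i a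
    using that by (simp add: fp_incl_def hcl e_simps fc)
  ultimately show ?thesis by blast
qed

lemma free_product_unique:
  assumes H: "group H" and h: "h \<in> hom (free_product I G) H" and k: "k \<in> hom (free_product I G) H"
    and eq: "\<And>i a. i \<in> I \<Longrightarrow> a \<in> carrier (G i) \<Longrightarrow> h (fp_incl I G i a) = k (fp_incl I G i a)"
    and x: "x \<in> carrier (free_product I G)"
  shows "h x = k x"
proof -
  have "h (fp_rel I G `` {u}) = k (fp_rel I G `` {u})" if "u \<in> fp_words I G" for u
    using that
  proof (induction u)
    case Nil
    then show ?case
      using hom_one[OF h group_free_product H] hom_one[OF k group_free_product H]
      by (simp add: fp_one)
  next
    case (Cons x u)
    obtain i a where x: "x = (i, a)" by force
    have ia: "i \<in> I" "a \<in> carrier (G i)" "u \<in> fp_words I G" using Cons.prems x by auto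
    have "fp_rel I G `` {x # u} = fp_incl I G i a \<otimes>\<^bsub>free_product I G\<^esub> (fp_rel I G `` {u})"
      using ia x by (simp add: fp_incl_def fp_mult)
    moreover have "fp_incl I G i a \<in> carrier (free_product I G)"
      using ia by (simp add: fp_incl_def fp_carrierI)
    ultimately show ?case
      using ia Cons.IH eq hom_mult[OF h] hom_mult[OF k] by (simp add: fp_carrierI)
  qed
  then show ?thesis using x by (auto elim: fp_carrierE)
qed

end

end

theory Submission
  imports Defs "HOL-Homology.Homology" "HOL-Analysis.Analysis" "HOL-Algebra.SndIsomorphismGrp"
    "HOL-Number_Theory.Cong"
begin

text \<open>Write \<open>G\<close> for the free product and \<open>a, b, c\<close> for generators of its three factors. Only two things
have to be shown: every element of \<open>G\<close> lies in a proper normal subgroup of finite index, and no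
finite family of such subgroups covers \<open>G\<close>. Together they force the family of all of them to be
infinite.

No finite cover. Enlarge the members of a finite family to maximal normal subgroups. If \<open>M\<close> is one
of them and \<open>G/M\<close> is not abelian, then \<open>M\<close> behaves like a prime ideal: it contains one of two normal
subgroups as soon as it contains their intersection, because two normal subgroups not inside \<open>M\<close> map
onto \<open>G/M\<close> and then the commutators between them do not all die there
(\<open>derived_le_maximal_normal\<close>). Hence an element of the coset \<open>abc G'\<close> can be corrected, one subgroup
at a time, to avoid all such \<open>M\<close>. The whole coset avoids the \<open>M\<close> with abelian quotient: there the images
of \<open>a, b, c\<close> have coprime orders, so \<open>abc\<close> dies only if everything does
(\<open>free_product_normally_generated_mod_derived\<close>).

Every element in some subgroup. This says that adding one relation \<open>u = 1\<close> to \<open>G\<close> leaves a group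
with a nontrivial finite quotient. That the quotient is nontrivial is the Scott-Wiegold conjecture,
and the argument is Howie's: find a nontrivial homomorphism to the rotation group killing \<open>u\<close>. Send
\<open>a, b, c\<close> to unit quaternions with prescribed angles \<open>\<Theta>\<close> in \<open>\<pi>\<int>/p\<close>, \<open>\<pi>\<int>/q\<close>, \<open>\<pi>\<int>/r\<close> and
free axes; they satisfy the relations of \<open>G\<close> up to sign. If the quaternion \<open>u\<close> evaluates to were
never real, its imaginary part would define a continuous map from triples of axes to nonzero
vectors. Fix the first axis and let the second one move along a half circle from the first to its
opposite. At both ends of this motion the map from the third axis to the normalized imaginary part
commutes with the rotations about the first axis, so its degree can be read off from its values at
the two poles, which are signs of sines of \<open>\<plusminus>\<close>-combinations of the angles. As the three primes are
distinct, angles can be chosen for which these degrees are \<open>1\<close> and \<open>-1\<close>, which is absurd since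
the two maps are homotopic (\<open>exists_axes_with_real_value\<close>, \<open>exists_rotations_killing_word\<close>).

It remains to pass from a linear group to a finite one, which is Malcev's argument: the matrices
have entries in a finitely generated subring of \<open>\<complex>\<close>, and such a ring has a proper ideal of finite
index modulo which a given nonzero element is still a unit
(\<open>finitely_generated_subring_inverts\<close>). Reducing the entries modulo that ideal gives the finite
quotient (\<open>linear_group_finite_quotient\<close>, \<open>free_product_elem_in_proper_normal\<close>).\<close>

section \<open>Residue rings of finitely generated domains\<close>

definition subring_set :: "'a::comm_ring_1 set \<Rightarrow> bool" where
  "subring_set S \<longleftrightarrow> 1 \<in> S \<and> (\<forall>a\<in>S. \<forall>b\<in>S. a - b \<in> S \<and> a * b \<in> S)"

definition ideal_of :: "'a::comm_ring_1 set \<Rightarrow> 'a set \<Rightarrow> bool" where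
  "ideal_of S I \<longleftrightarrow> I \<subseteq> S \<and> 0 \<in> I \<and> (\<forall>a\<in>I. \<forall>b\<in>I. a - b \<in> I) \<and> (\<forall>s\<in>S. \<forall>a\<in>I. s * a \<in> I)"

definition finite_quotient :: "'a::comm_ring_1 set \<Rightarrow> 'a set \<Rightarrow> bool" where
  "finite_quotient S I \<longleftrightarrow> (\<exists>T. finite T \<and> T \<subseteq> S \<and> (\<forall>s\<in>S. \<exists>t\<in>T. s - t \<in> I))"

text \<open>The property carried through the induction on generators. The residue ring may have zero divisors, so
\<open>d\<close> is asked to become a unit, and not only to be nonzero: leading coefficients can then be divided by.\<close>

definition finite_residue_inverts :: "'a::comm_ring_1 set \<Rightarrow> 'a \<Rightarrow> bool" where
  "finite_residue_inverts S d \<longleftrightarrow>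
    (\<exists>I e. ideal_of S I \<and> 1 \<notin> I \<and> finite_quotient S I \<and> e \<in> S \<and> d * e - 1 \<in> I)"

lemma subring_setD:
  assumes "subring_set S"
  shows "1 \<in> S" "0 \<in> S" "a \<in> S \<Longrightarrow> b \<in> S \<Longrightarrow> a - b \<in> S" "a \<in> S \<Longrightarrow> b \<in> S \<Longrightarrow> a * b \<in> S"
    "a \<in> S \<Longrightarrow> - a \<in> S" "a \<in> S \<Longrightarrow> b \<in> S \<Longrightarrow> a + b \<in> S" "a \<in> S \<Longrightarrow> a ^ k \<in> S"
proof -
  show *: "1 \<in> S" "a \<in> S \<Longrightarrow> b \<in> S \<Longrightarrow> a - b \<in> S" "a \<in> S \<Longrightarrow> b \<in> S \<Longrightarrow> a * b \<in> S" for a b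
    using assms by (auto simp: subring_set_def)
  show 0: "0 \<in> S" using *(2)[OF *(1) *(1)] by simp
  show m: "a \<in> S \<Longrightarrow> - a \<in> S" for a using *(2)[OF 0] by fastforce
  show "a \<in> S \<Longrightarrow> b \<in> S \<Longrightarrow> a + b \<in> S" using *(2)[of a "- b"] m by simp
  show "a \<in> S \<Longrightarrow> a ^ k \<in> S" by (induction k) (auto simp: *)
qed

lemma ideal_ofD:
  assumes "ideal_of S I"
  shows "I \<subseteq> S" "0 \<in> I" "a \<in> I \<Longrightarrow> b \<in> I \<Longrightarrow> a - b \<in> I" "a \<in> I \<Longrightarrow> b \<in> I \<Longrightarrow> a + b \<in> I"
    "s \<in> S \<Longrightarrow> a \<in> I \<Longrightarrow> s * a \<in> I" "s \<in> S \<Longrightarrow> a \<in> I \<Longrightarrow> a * s \<in> I" "a \<in> I \<Longrightarrow> - a \<in> I"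
proof -
  show *: "I \<subseteq> S" "0 \<in> I" "a \<in> I \<Longrightarrow> b \<in> I \<Longrightarrow> a - b \<in> I" "s \<in> S \<Longrightarrow> a \<in> I \<Longrightarrow> s * a \<in> I" for a b s
    using assms by (auto simp: ideal_of_def)
  show m: "a \<in> I \<Longrightarrow> - a \<in> I" for a using *(3)[OF *(2)] by fastforce
  show "a \<in> I \<Longrightarrow> b \<in> I \<Longrightarrow> a + b \<in> I" using *(3)[of a "- b"] m by simp
  show "s \<in> S \<Longrightarrow> a \<in> I \<Longrightarrow> a * s \<in> I" using *(4)[of s a] by (metis mult.commute)
qed

lemma ideal_of_sum: "ideal_of S I \<Longrightarrow> (\<And>i. i \<in> A \<Longrightarrow> f i \<in> I) \<Longrightarrow> sum f A \<in> I"
  by (induction A rule: infinite_finite_induct) (auto intro: ideal_ofD)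

lemma ideal_of_self: "subring_set S \<Longrightarrow> ideal_of S S"
  by (auto simp: ideal_of_def subring_setD)

lemma inverse_mod_power:
  assumes "subring_set S" "ideal_of S I" "c \<in> S" "e \<in> S" "c * e - 1 \<in> I"
  shows "c ^ k * e ^ k - 1 \<in> I"
proof (induction k)
  case 0
  then show ?case using assms by (simp add: ideal_ofD)
next
  case (Suc k)
  have "c ^ Suc k * e ^ Suc k - 1 = (c * e) * (c ^ k * e ^ k - 1) + (c * e - 1)"
    by (simp add: algebra_simps)
  moreover have "c * e \<in> S" using assms by (simp add: subring_setD)
  ultimately show ?case using Suc assms(5) by (metis ideal_ofD(4,5)[OF assms(2)])
qed

definition polys_over :: "'a::comm_ring_1 set \<Rightarrow> 'a poly set" where
  "polys_over J = {p. \<forall>i. coeff p i \<in> J}"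

lemma polys_over_diff: "ideal_of S J \<Longrightarrow> p \<in> polys_over J \<Longrightarrow> q \<in> polys_over J \<Longrightarrow> p - q \<in> polys_over J"
  by (auto simp: polys_over_def ideal_ofD)

lemma polys_over_add: "ideal_of S J \<Longrightarrow> p \<in> polys_over J \<Longrightarrow> q \<in> polys_over J \<Longrightarrow> p + q \<in> polys_over J"
  by (auto simp: polys_over_def ideal_ofD)

lemma polys_over_mult: "ideal_of S J \<Longrightarrow> p \<in> polys_over S \<Longrightarrow> q \<in> polys_over J \<Longrightarrow> p * q \<in> polys_over J"
  by (auto simp: polys_over_def coeff_mult intro!: ideal_of_sum ideal_ofD(5))

lemma polys_over_smult: "ideal_of S J \<Longrightarrow> c \<in> S \<Longrightarrow> q \<in> polys_over J \<Longrightarrow> smult c q \<in> polys_over J"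
  by (auto simp: polys_over_def ideal_ofD)

lemma polys_over_monom: "ideal_of S J \<Longrightarrow> c \<in> J \<Longrightarrow> monom c k \<in> polys_over J"
  by (auto simp: polys_over_def ideal_ofD)

lemma polys_over_mono: "ideal_of S J \<Longrightarrow> p \<in> polys_over J \<Longrightarrow> p \<in> polys_over S"
  using ideal_ofD(1) by (auto simp: polys_over_def)

lemma polys_over_const: "ideal_of S J \<Longrightarrow> [:c:] \<in> polys_over J \<longleftrightarrow> c \<in> J"
  by (auto simp: polys_over_def ideal_ofD coeff_pCons split: nat.splits intro: spec[of _ 0])

lemma polys_over_pCons: "c \<in> J \<Longrightarrow> p \<in> polys_over J \<Longrightarrow> pCons c p \<in> polys_over J"
  by (auto simp: polys_over_def coeff_pCons split: nat.splits)

text \<open>Division with remainder by a polynomial that need not be monic, after multiplying the dividend by a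
power of the leading coefficient. The extra ideal \<open>J\<close> records that a dividend with coefficients in
\<open>J\<close> leaves a remainder with coefficients in \<open>J\<close>; the case \<open>J = S\<close> is the plain statement.\<close>

lemma pseudo_division_over:
  fixes f g :: "'a::idom poly"
  assumes S: "subring_set S" and J: "ideal_of S J"
    and f: "f \<in> polys_over J" and g: "g \<in> polys_over S" "g \<noteq> 0"
  shows "\<exists>k q r. q \<in> polys_over S \<and> r \<in> polys_over J \<and> smult (lead_coeff g ^ k) f = q * g + r
    \<and> (r = 0 \<or> degree r < degree g)"
  using f
proof (induction "if f = 0 then 0 else Suc (degree f)" arbitrary: f rule: less_induct)
  case less
  have SS: "ideal_of S S" using S by (rule ideal_of_self)
  show ?case
  proof (cases "f = 0 \<or> degree f < degree g")
    case True
    then show ?thesis using less.prems SS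
      by (intro exI[of _ 0] exI[of _ f]) (auto simp: polys_over_def ideal_ofD)
  next
    case False
    define c where "c = lead_coeff g"
    define a where "a = lead_coeff f"
    define k where "k = degree f - degree g"
    define f' where "f' = smult c f - monom a k * g"
    have c: "c \<in> S" "c \<noteq> 0" using g by (auto simp: c_def polys_over_def)
    have a: "a \<in> J" using less.prems by (auto simp: a_def polys_over_def)
    then have aS: "a \<in> S" using J ideal_ofD by blast
    have "g * monom a k \<in> polys_over J"
      by (intro polys_over_mult[OF J] g polys_over_monom[OF J] a)
    then have f'J: "f' \<in> polys_over J"
      unfolding f'_def using less.prems J c
      by (auto intro!: polys_over_diff polys_over_smult simp: mult.commute)
    have a0: "a \<noteq> 0" using False by (simp add: a_def)
    have deg: "degree (smult c f) = degree f" "degree (monom a k * g) = degree f"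
      using c False a0 g by (auto simp: degree_mult_eq degree_monom_eq k_def monom_eq_0_iff)
    have "coeff f' (degree f) = 0"
      using False by (simp add: f'_def coeff_monom_mult k_def a_def c_def)
    then have small: "f' = 0 \<or> degree f' < degree f"
      using deg degree_diff_le[of "smult c f" "degree f" "monom a k * g"]
      unfolding f'_def[symmetric] by (metis le_neq_implies_less leading_coeff_0_iff order_refl)
    then have "(if f' = 0 then 0 else Suc (degree f')) < (if f = 0 then 0 else Suc (degree f))"
      using False by auto
    from less.hyps[OF this f'J] obtain m q r where
      *: "q \<in> polys_over S" "r \<in> polys_over J" "smult (c ^ m) f' = q * g + r" "r = 0 \<or> degree r < degree g"
      unfolding c_def by blast
    have "smult (c ^ Suc m) f = smult (c ^ m) f' + smult (c ^ m) (monom a k) * g"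
      by (simp add: f'_def smult_diff_right mult.commute)
    also have "\<dots> = (q + smult (c ^ m) (monom a k)) * g + r"
      using * by (simp add: algebra_simps)
    finally show ?thesis
      using * c aS unfolding c_def[symmetric]
      by (intro exI[of _ "Suc m"] exI[of _ "q + smult (c ^ m) (monom a k)"] exI[of _ r])
        (auto intro!: polys_over_add[OF SS] polys_over_smult[OF SS] polys_over_monom[OF SS] subring_setD[OF S])
  qed
qed

definition adjoin :: "'a::comm_ring_1 set \<Rightarrow> 'a \<Rightarrow> 'a set" where
  "adjoin S x = (\<lambda>p. poly p x) ` polys_over S"

lemma subring_adjoin:
  assumes S: "subring_set S" shows "subring_set (adjoin S x)"
proof -
  have SS: "ideal_of S S" using S by (rule ideal_of_self)
  have "poly [:1:] x \<in> adjoin S x" unfolding adjoin_def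
    using polys_over_const[OF SS] subring_setD(1)[OF S] by blast
  then show ?thesis
    unfolding subring_set_def adjoin_def
    using polys_over_diff[OF SS] polys_over_mult[OF SS]
    by (auto simp flip: poly_diff poly_mult)
qed

lemma adjoin_base: "subring_set S \<Longrightarrow> s \<in> S \<Longrightarrow> s \<in> adjoin S x"
  unfolding adjoin_def using polys_over_const[OF ideal_of_self, of S s]
  by (intro image_eqI[of _ _ "[:s:]"]) auto

lemma adjoin_gen: "subring_set S \<Longrightarrow> x \<in> adjoin S x"
  unfolding adjoin_def using polys_over_monom[OF ideal_of_self, of S 1 1]
  by (intro image_eqI[of _ _ "monom 1 1"]) (auto simp: poly_monom subring_setD)

text \<open>Modulo \<open>I\<close> the leading coefficient of \<open>m\<close> is a unit, so \<open>x\<close> satisfies a monic equation there: every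
residue is a combination of the powers of \<open>x\<close> below \<open>degree m\<close>, with coefficients from a finite set of
representatives of \<open>S\<close> modulo \<open>J\<close>.\<close>

lemma finite_quotient_adjoin:
  fixes x :: "'a::idom"
  assumes S: "subring_set S" and J: "ideal_of S J" "finite_quotient S J"
    and I: "ideal_of (adjoin S x) I" "J \<subseteq> I"
    and m: "m \<in> polys_over S" "m \<noteq> 0" "poly m x \<in> I"
    and e: "e \<in> S" "lead_coeff m * e - 1 \<in> J"
  shows "finite_quotient (adjoin S x) I"
proof -
  have SS: "ideal_of S S" using S by (rule ideal_of_self)
  obtain T where T: "finite T" "T \<subseteq> S" "\<And>s. s \<in> S \<Longrightarrow> \<exists>t\<in>T. s - t \<in> J"
    using J(2) by (auto simp: finite_quotient_def)
  then obtain rep where rep: "\<And>s. s \<in> S \<Longrightarrow> rep s \<in> T \<and> s - rep s \<in> J" by metis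
  let ?n = "degree m"
  define val where "val t = (\<Sum>i<?n. t i * x ^ i)" for t
  define U where "U = val ` ({..<?n} \<rightarrow>\<^sub>E T)"
  have A: "subring_set (adjoin S x)" using S by (rule subring_adjoin)
  have val_adj: "val t \<in> adjoin S x" if "\<And>i. i < ?n \<Longrightarrow> t i \<in> S" for t
    unfolding val_def using that S
    by (intro ideal_of_sum[OF ideal_of_self[OF A]] subring_setD(4,7)[OF A] adjoin_gen adjoin_base) auto
  have "\<exists>u\<in>U. y - u \<in> I" if y: "y \<in> adjoin S x" for y
  proof -
    obtain f where f: "f \<in> polys_over S" "y = poly f x" using y by (auto simp: adjoin_def)
    define c where "c = lead_coeff m"
    obtain k q r where qr: "q \<in> polys_over S" "r \<in> polys_over S"
      "smult (c ^ k) f = q * m + r" "r = 0 \<or> degree r < ?n"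
      using pseudo_division_over[OF S SS f(1) m(1,2)] unfolding c_def by blast
    have cS: "c \<in> S" using m by (auto simp: c_def polys_over_def)
    define r' where "r' = smult (e ^ k) r"
    have r': "r' \<in> polys_over S" "r' = 0 \<or> degree r' < ?n"
      unfolding r'_def using qr e by (auto intro!: polys_over_smult[OF SS] subring_setD[OF S])
    have r'x: "poly r' x = val (coeff r')"
    proof (cases "r' = 0")
      case False
      have "poly r' x = (\<Sum>i\<in>{..degree r'}. coeff r' i * x ^ i)" by (simp add: poly_altdef)
      also have "\<dots> = (\<Sum>i\<in>{..<max ?n (Suc (degree r'))}. coeff r' i * x ^ i)"
        by (rule sum.mono_neutral_left) (auto simp: coeff_eq_0)
      also have "\<dots> = val (coeff r')" unfolding val_def
        using r'(2) False by (intro sum.mono_neutral_right) (auto intro!: coeff_eq_0)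
      finally show ?thesis .
    qed (simp add: val_def)
    have ceJ: "c ^ k * e ^ k - 1 \<in> I"
      using inverse_mod_power[OF S J(1) cS e(1)] e(2) I(2) unfolding c_def by blast
    have "c ^ k * y = poly q x * poly m x + poly r x"
      using arg_cong[OF qr(3), of "\<lambda>p. poly p x"] f by simp
    then have "e ^ k * (c ^ k * y) = e ^ k * (poly q x * poly m x + poly r x)" by simp
    then have "y - poly r' x = e ^ k * (poly q x * poly m x) - (c ^ k * e ^ k - 1) * y"
      unfolding r'_def by (simp add: algebra_simps)
    also have "\<dots> \<in> I"
    proof (rule ideal_ofD(3)[OF I(1)])
      have "poly q x \<in> adjoin S x" using qr(1) by (auto simp: adjoin_def)
      then show "e ^ k * (poly q x * poly m x) \<in> I"
        using m(3) subring_setD(7)[OF A adjoin_base[OF S e(1)]] by (blast intro: ideal_ofD(5)[OF I(1)])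
      show "(c ^ k * e ^ k - 1) * y \<in> I" by (rule ideal_ofD(6)[OF I(1) y ceJ])
    qed
    finally have 1: "y - poly r' x \<in> I" .
    define t where "t = restrict (rep \<circ> coeff r') {..<?n}"
    have tT: "t \<in> {..<?n} \<rightarrow>\<^sub>E T" unfolding t_def
      using r'(1) rep by (auto simp: polys_over_def)
    have "poly r' x - val t = (\<Sum>i<?n. (coeff r' i - rep (coeff r' i)) * x ^ i)"
      unfolding r'x val_def t_def by (simp add: sum_subtractf left_diff_distrib)
    also have "\<dots> \<in> I"
      using r'(1) rep I(2) A S
      by (intro ideal_of_sum[OF I(1)] ideal_ofD(6)[OF I(1)]) (auto intro!: subring_setD(7) adjoin_gen simp: polys_over_def)
    finally have "poly r' x - val t \<in> I" .
    then have "y - val t \<in> I" using ideal_ofD(4)[OF I(1) 1] by fastforce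
    then show ?thesis using tT by (auto simp: U_def)
  qed
  moreover have "finite U" unfolding U_def using T by (intro finite_imageI finite_PiE) auto
  moreover have "U \<subseteq> adjoin S x"
    unfolding U_def using T(2) by (auto intro!: val_adj)
  ultimately show ?thesis unfolding finite_quotient_def by blast
qed

text \<open>Write \<open>d\<close> as \<open>poly D x\<close>. The ideal generated by \<open>d x - 1\<close> and by an ideal \<open>J\<close> of \<open>S\<close> inverting the
leading coefficient of \<open>D\<close> makes \<open>d\<close> a unit with inverse \<open>x\<close>, and has finite index because
\<open>X D - 1\<close> has an invertible leading coefficient modulo \<open>J\<close>. It is proper because identities in \<open>x\<close>
are identities of polynomials, and a polynomial of positive degree whose leading coefficient is a unit
modulo \<open>J\<close> has no polynomial inverse modulo \<open>J\<close>.\<close>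

lemma adjoin_transcendental_inverts:
  fixes x :: "'a::idom"
  assumes S: "subring_set S" and res: "\<And>d. d \<in> S \<Longrightarrow> d \<noteq> 0 \<Longrightarrow> finite_residue_inverts S d"
    and x: "\<And>p. p \<in> polys_over S \<Longrightarrow> poly p x = 0 \<Longrightarrow> p = 0"
    and d: "d \<in> adjoin S x" "d \<noteq> 0"
  shows "finite_residue_inverts (adjoin S x) d"
proof -
  have SS: "ideal_of S S" using S by (rule ideal_of_self)
  obtain D where D: "D \<in> polys_over S" "d = poly D x" using d by (auto simp: adjoin_def)
  have D0: "D \<noteq> 0" using D d by auto
  define m where "m = pCons (-1) D"
  have m: "m \<in> polys_over S" "m \<noteq> 0" "lead_coeff m = lead_coeff D" "degree m \<ge> 1"
    using D D0 S by (auto simp: m_def intro!: polys_over_pCons subring_setD)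
  have "lead_coeff D \<in> S" "lead_coeff D \<noteq> 0" using D D0 by (auto simp: polys_over_def)
  from res[OF this] obtain J e where J: "ideal_of S J" "1 \<notin> J" "finite_quotient S J"
    and e: "e \<in> S" "lead_coeff m * e - 1 \<in> J"
    unfolding finite_residue_inverts_def m(3) by blast
  define I where "I = {poly (A + m * H) x |A H. A \<in> polys_over J \<and> H \<in> polys_over S}"
  have J0: "0 \<in> polys_over J" "0 \<in> polys_over S" using J(1) SS by (auto simp: polys_over_def ideal_ofD)
  have I: "ideal_of (adjoin S x) I"
    unfolding ideal_of_def
  proof (intro conjI ballI)
    show "I \<subseteq> adjoin S x"
      unfolding I_def adjoin_def using polys_over_mono[OF J(1)] m(1)
        polys_over_add[OF SS] polys_over_mult[OF SS] by blast
    show "0 \<in> I" unfolding I_def using J0 by (auto intro!: exI[of _ 0])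
  next
    fix a b assume "a \<in> I" "b \<in> I"
    then obtain A H A' H' where *: "A \<in> polys_over J" "H \<in> polys_over S" "A' \<in> polys_over J" "H' \<in> polys_over S"
      "a = poly (A + m * H) x" "b = poly (A' + m * H') x" unfolding I_def by blast
    then have "a - b = poly ((A - A') + m * (H - H')) x" by (simp add: algebra_simps)
    then show "a - b \<in> I" unfolding I_def using * polys_over_diff[OF J(1)] polys_over_diff[OF SS] by blast
  next
    fix s a assume "s \<in> adjoin S x" "a \<in> I"
    then obtain A H p where *: "A \<in> polys_over J" "H \<in> polys_over S" "p \<in> polys_over S"
      "a = poly (A + m * H) x" "s = poly p x" unfolding I_def adjoin_def by blast
    then have "s * a = poly (p * A + m * (p * H)) x" by (simp add: algebra_simps)
    then show "s * a \<in> I" unfolding I_def using * polys_over_mult[OF J(1)] polys_over_mult[OF SS] by blast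
  qed
  have JI: "J \<subseteq> I"
  proof
    fix j assume "j \<in> J"
    then have "[:j:] \<in> polys_over J" using J(1) by (simp add: polys_over_const)
    then have "poly ([:j:] + m * 0) x \<in> I" unfolding I_def using J0(2) by blast
    then show "j \<in> I" by simp
  qed
  have mI: "poly m x \<in> I"
  proof -
    have "poly (0 + m * [:1:]) x \<in> I"
      unfolding I_def using J0(1) polys_over_const[OF SS, of 1] subring_setD(1)[OF S] by blast
    then show ?thesis by simp
  qed
  have "1 \<notin> I"
  proof
    assume "1 \<in> I"
    then obtain A H where AH: "A \<in> polys_over J" "H \<in> polys_over S" "poly (A + m * H) x = 1"
      unfolding I_def by auto
    then have "poly (A + m * H - [:1:]) x = 0" by simp
    moreover have "A + m * H - [:1:] \<in> polys_over S"
      using AH m(1) J(1) subring_setD(1)[OF S]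
      by (intro polys_over_diff[OF SS] polys_over_add[OF SS] polys_over_mult[OF SS])
        (auto simp: polys_over_const[OF SS] intro: polys_over_mono)
    ultimately have eq: "A + m * H = [:1:]" using x by fastforce
    have cH: "coeff H i \<in> S" "coeff m i \<in> S" "coeff A i \<in> J" for i using AH m(1) by (auto simp: polys_over_def)
    show False
    proof (cases "\<forall>i. coeff H i \<in> J")
      case True
      then have "A + m * H \<in> polys_over J"
        using AH m(1) by (intro polys_over_add[OF J(1)] polys_over_mult[OF J(1)]) (auto simp: polys_over_def)
      then show False using eq J(1,2) by (simp add: polys_over_const)
    next
      case False
      let ?B = "{i. coeff H i \<notin> J}"
      have "?B \<subseteq> {..degree H}" using ideal_ofD(2)[OF J(1)] by (auto intro: le_degree)
      then have fin: "finite ?B" by (rule finite_subset) auto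
      \<comment> \<open>The coefficient of \<open>m * H\<close> at \<open>degree m + h\<close> is, modulo \<open>J\<close>, the product of the leading
    coefficient of \<open>m\<close>, a unit, with the last coefficient of \<open>H\<close> outside \<open>J\<close>.\<close>
      define h where "h = Max ?B"
      have h: "coeff H h \<notin> J" "\<And>i. i > h \<Longrightarrow> coeff H i \<in> J"
        using Max_in[OF fin] Max_ge[OF fin] False by (auto simp: h_def not_le) (metis not_less)
      let ?n = "degree m"
      have "(\<Sum>i\<in>{..?n + h} - {?n}. coeff m i * coeff H (?n + h - i)) \<in> J"
      proof (rule ideal_of_sum[OF J(1)])
        fix i assume i: "i \<in> {..?n + h} - {?n}"
        show "coeff m i * coeff H (?n + h - i) \<in> J"
        proof (cases "i < ?n")
          case True
          then show ?thesis using h(2) cH by (intro ideal_ofD(5)[OF J(1)]) auto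
        next
          case False
          then have "coeff m i = 0" using i by (intro coeff_eq_0) auto
          then show ?thesis using ideal_ofD(2)[OF J(1)] by simp
        qed
      qed
      moreover have "coeff (m * H) (?n + h)
          = lead_coeff m * coeff H h + (\<Sum>i\<in>{..?n + h} - {?n}. coeff m i * coeff H (?n + h - i))"
        unfolding coeff_mult by (subst sum.remove[of _ ?n]) auto
      moreover have "coeff (m * H) (?n + h) \<in> J"
      proof -
        have "coeff (A + m * H) (?n + h) = 0"
          unfolding eq using m(4) by (simp add: coeff_pCons split: nat.split)
        then have "coeff (m * H) (?n + h) = - coeff A (?n + h)" by (simp add: eq_neg_iff_add_eq_0 add.commute)
        then show ?thesis using cH ideal_ofD(7)[OF J(1)] by simp
      qed
      ultimately have "lead_coeff m * coeff H h \<in> J"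
        using ideal_ofD(3)[OF J(1)] by (metis add_diff_cancel_right')
      then have "e * (lead_coeff m * coeff H h) - (lead_coeff m * e - 1) * coeff H h \<in> J"
        using e cH by (blast intro: ideal_ofD(3,5,6)[OF J(1)])
      then show False using h(1) by (simp add: algebra_simps)
    qed
  qed
  moreover have "finite_quotient (adjoin S x) I"
    by (rule finite_quotient_adjoin[OF S J(1,3) I JI m(1,2) mI e])
  moreover have "d * x - 1 \<in> I"
    using mI by (simp add: m_def D algebra_simps)
  ultimately show ?thesis
    unfolding finite_residue_inverts_def using I adjoin_gen[OF S] by blast
qed

text \<open>Among the multiples \<open>poly r x\<close>
of \<open>d\<close> that do not vanish take one with \<open>degree r\<close> minimal. Dividing by \<open>m\<close> shows that \<open>degree r\<close> is
below \<open>degree m\<close>; then dividing \<open>m\<close> by \<open>r\<close> would produce a smaller multiple, or a factorization of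
\<open>m\<close> that contradicts its minimality, unless \<open>r\<close> is constant.\<close>

lemma adjoin_algebraic_divides_scalar:
  fixes x :: "'a::idom"
  assumes S: "subring_set S"
    and m: "m \<in> polys_over S" "m \<noteq> 0" "poly m x = 0"
    and min: "\<And>p. p \<in> polys_over S \<Longrightarrow> poly p x = 0 \<Longrightarrow> p = 0 \<or> degree m \<le> degree p"
    and d: "d \<in> adjoin S x" "d \<noteq> 0"
  shows "\<exists>u\<in>adjoin S x. d * u \<in> S \<and> d * u \<noteq> 0"
proof -
  have SS: "ideal_of S S" using S by (rule ideal_of_self)
  have A: "subring_set (adjoin S x)" using S by (rule subring_adjoin)
  define good where "good r \<longleftrightarrow> r \<in> polys_over S \<and> poly r x \<noteq> 0 \<and> (\<exists>u\<in>adjoin S x. poly r x = d * u)" for r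
  obtain D where D: "D \<in> polys_over S" "d = poly D x" using d by (auto simp: adjoin_def)
  have "good D" unfolding good_def using D d A by (auto intro!: bexI[of _ 1] subring_setD)
  then obtain r where r: "good r" and rmin: "\<And>s. good s \<Longrightarrow> degree r \<le> degree s"
    using exists_least_lemma[of "\<lambda>n. \<exists>s. good s \<and> degree s = n"] ex_has_least_nat[of good D degree] by blast
  obtain u where u: "u \<in> adjoin S x" "poly r x = d * u" using r good_def by blast
  have rS: "r \<in> polys_over S" "poly r x \<noteq> 0" "r \<noteq> 0" using r by (auto simp: good_def)
  have mS: "coeff m i \<in> S" for i using m by (auto simp: polys_over_def)
  have "degree r < degree m"
  proof -
    obtain k q s where qs: "q \<in> polys_over S" "s \<in> polys_over S"
      "smult (lead_coeff m ^ k) r = q * m + s" "s = 0 \<or> degree s < degree m"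
      using pseudo_division_over[OF S SS rS(1) m(1,2)] by blast
    have "lead_coeff m ^ k * poly r x = poly s x"
      using arg_cong[OF qs(3), of "\<lambda>p. poly p x"] m(3) by simp
    moreover have "lead_coeff m ^ k * poly r x = d * (lead_coeff m ^ k * u)"
      using u by simp
    moreover have "lead_coeff m ^ k * u \<in> adjoin S x"
      by (rule subring_setD(4)[OF A subring_setD(7)[OF A adjoin_base[OF S mS]] u(1)])
    ultimately have "good s"
      unfolding good_def using rS m(2) qs by (metis leading_coeff_0_iff mult_eq_0_iff power_not_zero)
    moreover have "s \<noteq> 0" using \<open>good s\<close> by (auto simp: good_def)
    ultimately show ?thesis using rmin qs(4) by fastforce
  qed
  have "degree r = 0"
  proof (rule ccontr)
    assume r0: "degree r \<noteq> 0"
    obtain k q s where qs: "q \<in> polys_over S" "s \<in> polys_over S"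
      "smult (lead_coeff r ^ k) m = q * r + s" "s = 0 \<or> degree s < degree r"
      using pseudo_division_over[OF S SS m(1) rS(1,3)] by blast
    have ev: "poly q x * poly r x + poly s x = 0"
      using arg_cong[OF qs(3), of "\<lambda>p. poly p x"] m(3) by simp
    show False
    proof (cases "poly s x = 0")
      case True
      then have s0: "s = 0" using min[OF qs(2)] qs(4) \<open>degree r < degree m\<close> by auto
      have qx: "poly q x = 0" using ev True rS(2) by simp
      have "q * r \<noteq> 0" using qs(3) s0 m(2) rS(3) by (metis add.right_neutral leading_coeff_0_iff power_not_zero smult_eq_0_iff)
      then have q0: "q \<noteq> 0" by auto
      have "degree m = degree q + degree r"
        using arg_cong[OF qs(3), of degree] s0 q0 rS(3) by (simp add: degree_mult_eq)
      then show False using min[OF qs(1) qx] q0 r0 by auto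
    next
      case False
      have "poly s x = - (poly q x * poly r x)" using ev by (simp add: eq_neg_iff_add_eq_0 add.commute)
      also have "\<dots> = d * (- (poly q x * u))" using u by simp
      finally have "poly s x = d * (- (poly q x * u))" .
      moreover have "- (poly q x * u) \<in> adjoin S x"
        using qs(1) by (intro subring_setD(4,5)[OF A] u) (auto simp: adjoin_def)
      ultimately have "good s" unfolding good_def using False qs(2) by blast
      then show False using rmin qs(4) False by fastforce
    qed
  qed
  then obtain c where c: "r = [:c:]" by (rule degree_eq_zeroE)
  then show ?thesis using u rS polys_over_const[OF SS] by (intro bexI[of _ u]) auto
qed

text \<open>Choose \<open>J\<close> inverting both the leading coefficient \<open>c\<close> of the minimal polynomial \<open>m\<close> and a scalar
multiple of \<open>d\<close>. The extended ideal \<open>J[x]\<close> then has finite index and makes \<open>d\<close> a unit. Were it to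
contain \<open>1\<close>, pseudo-division by \<open>m\<close> would give a power of \<open>c\<close> as the value at \<open>x\<close> of a polynomial over
\<open>J\<close> of degree below \<open>degree m\<close>; minimality makes this an identity of polynomials, so a power of \<open>c\<close>,
a unit modulo \<open>J\<close>, would lie in \<open>J\<close>.\<close>

lemma adjoin_algebraic_inverts:
  fixes x :: "'a::idom"
  assumes S: "subring_set S" and res: "\<And>d. d \<in> S \<Longrightarrow> d \<noteq> 0 \<Longrightarrow> finite_residue_inverts S d"
    and m: "m \<in> polys_over S" "m \<noteq> 0" "poly m x = 0"
    and min: "\<And>p. p \<in> polys_over S \<Longrightarrow> poly p x = 0 \<Longrightarrow> p = 0 \<or> degree m \<le> degree p"
    and d: "d \<in> adjoin S x" "d \<noteq> 0"
  shows "finite_residue_inverts (adjoin S x) d"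
proof -
  have SS: "ideal_of S S" using S by (rule ideal_of_self)
  have A: "subring_set (adjoin S x)" using S by (rule subring_adjoin)
  obtain u where u: "u \<in> adjoin S x" "d * u \<in> S" "d * u \<noteq> 0"
    using adjoin_algebraic_divides_scalar[OF S m min d] by blast
  define c where "c = lead_coeff m"
  have c: "c \<in> S" "c \<noteq> 0" using m by (auto simp: c_def polys_over_def)
  have "c * (d * u) \<in> S" "c * (d * u) \<noteq> 0" using c u S by (auto intro: subring_setD)
  from res[OF this] obtain J e where J: "ideal_of S J" "1 \<notin> J" "finite_quotient S J"
    and e: "e \<in> S" "c * (d * u) * e - 1 \<in> J"
    unfolding finite_residue_inverts_def by blast
  define I where "I = (\<lambda>p. poly p x) ` polys_over J"
  have J0: "0 \<in> polys_over J" using J(1) by (auto simp: polys_over_def ideal_ofD)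
  have I: "ideal_of (adjoin S x) I"
    unfolding ideal_of_def I_def adjoin_def
    using polys_over_mono[OF J(1)] J0 polys_over_diff[OF J(1)] polys_over_mult[OF J(1)]
    by (auto simp flip: poly_diff poly_mult intro!: image_eqI[of 0 _ 0])
  have JI: "J \<subseteq> I"
    unfolding I_def using polys_over_const[OF J(1)] by (auto intro!: image_eqI[of _ _ "[:_:]"])
  have mI: "poly m x \<in> I" using m(3) ideal_ofD(2)[OF I] by simp
  have ce: "d * u * e \<in> S" "c * (d * u * e) - 1 \<in> J"
    using e(2) subring_setD(4)[OF S u(2) e(1)] by (simp_all add: mult.assoc)
  have "1 \<notin> I"
  proof
    assume "1 \<in> I"
    then obtain f where f: "f \<in> polys_over J" "poly f x = 1" by (auto simp: I_def)
    obtain k q r where qr: "q \<in> polys_over S" "r \<in> polys_over J"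
      "smult (c ^ k) f = q * m + r" "r = 0 \<or> degree r < degree m"
      using pseudo_division_over[OF S J(1) f(1) m(1,2)] unfolding c_def by blast
    have "c ^ k = poly r x"
      using arg_cong[OF qr(3), of "\<lambda>p. poly p x"] f(2) m(3) by simp
    then have "poly (r - [:c ^ k:]) x = 0" by simp
    moreover have "r - [:c ^ k:] \<in> polys_over S"
      using qr(2) c S by (intro polys_over_diff[OF SS]) (auto simp: polys_over_const[OF SS] subring_setD intro: polys_over_mono[OF J(1)])
    moreover have "r - [:c ^ k:] = 0 \<or> degree (r - [:c ^ k:]) < degree m"
    proof -
      have "degree m \<noteq> 0"
      proof
        assume "degree m = 0"
        then obtain b where "m = [:b:]" by (rule degree_eq_zeroE)
        then show False using m by simp
      qed
      then show ?thesis using qr(4) by (auto intro: le_less_trans[OF degree_diff_le_max])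
    qed
    ultimately have "r = [:c ^ k:]" using min by fastforce
    then have "c ^ k \<in> J" using qr(2) polys_over_const[OF J(1)] by simp
    then have "c ^ k * (d * u * e) ^ k - (c ^ k * (d * u * e) ^ k - 1) \<in> J"
      using inverse_mod_power[OF S J(1) c(1) ce, of k] subring_setD(7)[OF S ce(1)]
      by (blast intro: ideal_ofD(3,6)[OF J(1)])
    then show False using J(2) by simp
  qed
  moreover have "finite_quotient (adjoin S x) I"
    by (rule finite_quotient_adjoin[OF S J(1,3) I JI m(1,2) mI ce[unfolded c_def]])
  moreover have "d * (c * u * e) - 1 \<in> I"
    using e(2) JI by (auto simp: algebra_simps)
  moreover have "c * u * e \<in> adjoin S x"
    using c e u S A by (auto intro: subring_setD adjoin_base)
  ultimately show ?thesis
    unfolding finite_residue_inverts_def using I by blast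
qed

lemma finite_residue_inverts_integers:
  fixes d :: "'a::{idom,ring_char_0}"
  assumes "d \<in> \<int>" "d \<noteq> 0"
  shows "finite_residue_inverts \<int> d"
proof -
  obtain n where n: "d = of_int n" using assms by (auto elim: Ints_cases)
  have n0: "n \<noteq> 0" using assms n by auto
  \<comment> \<open>Modulo \<open>n\<^sup>2 + 1\<close> the integer \<open>n\<close> has the inverse \<open>-n\<close>.\<close>
  define N where "N = n\<^sup>2 + 1"
  have N: "N > 1" using n0 by (simp add: N_def)
  let ?I = "{of_int (N * k) | k. True} :: 'a set"
  have "ideal_of \<int> ?I"
    unfolding ideal_of_def
  proof (intro conjI ballI)
    show "?I \<subseteq> \<int>" by auto
    show "0 \<in> ?I" by (auto intro!: exI[of _ 0])
    show "a - b \<in> ?I" if ab: "a \<in> ?I" "b \<in> ?I" for a b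
    proof -
      obtain k l where "a = of_int (N * k)" "b = of_int (N * l)" using ab by auto
      then have "a - b = of_int (N * (k - l))" by (simp add: algebra_simps)
      then show ?thesis by blast
    qed
    show "s * a \<in> ?I" if sa: "s \<in> \<int>" "a \<in> ?I" for s a
    proof -
      obtain k l where "s = of_int k" "a = of_int (N * l)" using sa by (blast elim: Ints_cases)
      then have "s * a = of_int (N * (k * l))" by (simp add: algebra_simps)
      then show ?thesis by blast
    qed
  qed
  moreover have "1 \<notin> ?I"
  proof
    assume "1 \<in> ?I"
    then obtain k where "(1::'a) = of_int (N * k)" by blast
    then have "N * k = 1" using of_int_eq_iff[of 1 "N * k", where ?'a = 'a] by simp
    then show False using N by (simp add: zmult_eq_1_iff)
  qed
  moreover have "finite_quotient \<int> ?I"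
    unfolding finite_quotient_def
  proof (intro exI[of _ "of_int ` {0..<N}"] conjI ballI)
    fix s :: 'a assume "s \<in> \<int>"
    then obtain k where k: "s = of_int k" by (auto elim: Ints_cases)
    have "k - k mod N = N * (k div N)" by (simp add: minus_mod_eq_mult_div)
    then have "s - of_int (k mod N) = of_int (N * (k div N))" using k by (metis of_int_diff)
    moreover have "k mod N \<in> {0..<N}" using N by simp
    ultimately show "\<exists>t\<in>of_int ` {0..<N}. s - t \<in> ?I" by blast
  qed auto
  moreover have "d * (- d) - 1 \<in> ?I"
    using n by (auto simp: N_def power2_eq_square algebra_simps intro!: exI[of _ "-1"])
  ultimately show ?thesis
    unfolding finite_residue_inverts_def using assms by (intro exI[of _ ?I] exI[of _ "-d"]) auto
qed

text \<open>The form of the Nullstellensatz over the integers that the reduction to finite groups needs: adjoin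
the generators one after another.\<close>

lemma finitely_generated_subring_inverts:
  fixes X :: "'a::{idom,ring_char_0} set"
  assumes "finite X"
  shows "\<exists>S. subring_set S \<and> X \<subseteq> S \<and> (\<forall>d\<in>S. d \<noteq> 0 \<longrightarrow> finite_residue_inverts S d)"
  using assms
proof (induction X)
  case empty
  then show ?case
    by (intro exI[of _ \<int>]) (auto simp: subring_set_def finite_residue_inverts_integers)
next
  case (insert x X)
  from insert.IH obtain S where S: "subring_set S" "X \<subseteq> S"
    and "\<forall>d\<in>S. d \<noteq> 0 \<longrightarrow> finite_residue_inverts S d" by (elim exE conjE)
  then have res: "finite_residue_inverts S d" if "d \<in> S" "d \<noteq> 0" for d using that by simp
  have "finite_residue_inverts (adjoin S x) d" if d: "d \<in> adjoin S x" "d \<noteq> 0" for d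
  proof (cases "\<exists>p. p \<in> polys_over S \<and> poly p x = 0 \<and> p \<noteq> 0")
    case True
    then obtain p0 where "p0 \<in> polys_over S \<and> poly p0 x = 0 \<and> p0 \<noteq> 0" by (elim exE)
    then obtain m where m: "m \<in> polys_over S \<and> poly m x = 0 \<and> m \<noteq> 0"
      and min: "\<forall>p. p \<in> polys_over S \<and> poly p x = 0 \<and> p \<noteq> 0 \<longrightarrow> degree m \<le> degree p"
      using ex_has_least_nat[of "\<lambda>p. p \<in> polys_over S \<and> poly p x = 0 \<and> p \<noteq> 0" p0 degree] by metis
    show ?thesis
      by (rule adjoin_algebraic_inverts[OF S(1) res _ _ _ _ d]) (use m min in auto)
  next
    case False
    show ?thesis
      by (rule adjoin_transcendental_inverts[OF S(1) res _ d]) (use False in auto)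
  qed
  then show ?case
    using subring_adjoin[OF S(1)] adjoin_gen[OF S(1)] adjoin_base[OF S(1)] S(2)
    by (intro exI[of _ "adjoin S x"]) auto
qed

section \<open>Self-maps of the sphere commuting with the rotations about an axis\<close>

text \<open>The sphere is modelled in \<open>\<real> \<times> \<complex>\<close> so that the rotations about the axis through the poles
\<open>(1, 0)\<close> and \<open>(-1, 0)\<close> are multiplications of the second component by complex numbers of modulus
one.\<close>

abbreviation S2 :: "(real \<times> complex) set" where "S2 \<equiv> sphere 0 1"

lemma S2_iff: "(h, w) \<in> S2 \<longleftrightarrow> h\<^sup>2 + (norm w)\<^sup>2 = 1"
  by (simp add: norm_Pair)

lemma homotopic_canonI:
  fixes H :: "real \<times> 'a::topological_space \<Rightarrow> 'b::topological_space"
  assumes "continuous_on ({0..1} \<times> S) H" "H \<in> {0..1} \<times> S \<rightarrow> T"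
    and "\<And>x. x \<in> S \<Longrightarrow> H (0, x) = f x" "\<And>x. x \<in> S \<Longrightarrow> H (1, x) = g x"
  shows "homotopic_with_canon (\<lambda>_. True) S T f g"
proof -
  have "homotopic_with_canon (\<lambda>_. True) S T (\<lambda>x. H (0, x)) (\<lambda>x. H (1, x))"
    unfolding homotopic_with_def using assms(1,2)
    by (intro exI[of _ H]) (auto simp flip: subtopology_Times simp: continuous_map_in_subtopology)
  then show ?thesis
    by (rule homotopic_with_eq) (use assms(3,4) in auto)
qed

definition refl2 :: "real \<times> complex \<Rightarrow> real \<times> complex" where
  "refl2 x = (- fst x, snd x)"

text \<open>The degrees are \<open>1\<close> and \<open>-1\<close>; coordinates carry the sphere in \<open>\<real> \<times> \<complex>\<close> to the standard one, on
which the degree is defined.\<close>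

lemma identity_not_homotopic_to_reflection:
  "\<not> homotopic_with_canon (\<lambda>_. True) S2 S2 (\<lambda>x. x) refl2"
proof
  assume hom: "homotopic_with_canon (\<lambda>_. True) S2 S2 (\<lambda>x. x) refl2"
  define i :: "(nat \<Rightarrow> real) \<Rightarrow> real \<times> complex" where "i = (\<lambda>x. (x 0, Complex (x 1) (x 2)))"
  define j :: "real \<times> complex \<Rightarrow> nat \<Rightarrow> real" where
    "j = (\<lambda>u n. if n = 0 then fst u else if n = 1 then Re (snd u) else if n = 2 then Im (snd u) else 0)"
  have sum3: "(\<Sum>k\<le>2::nat. f k) = f 0 + f 1 + f 2" for f :: "nat \<Rightarrow> real"
    by (simp add: numeral_2_eq_2)
  have i: "continuous_map (nsphere 2) (top_of_set S2) i"
    unfolding continuous_map_in_subtopology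
  proof
    have "continuous_map (nsphere 2) euclidean (\<lambda>x. (x 0, complex_of_real (x 1) + \<i> * complex_of_real (x 2)))"
    proof -
      have c: "continuous_map (nsphere 2) euclidean (\<lambda>x. complex_of_real (x k))" for k
        using continuous_map_compose[OF continuous_map_nsphere_projection[of 2 k], of euclidean complex_of_real]
        by (simp add: o_def continuous_on_of_real_id)
      have m: "continuous_map (nsphere 2) euclidean (\<lambda>x. \<i> * complex_of_real (x 2))"
        using continuous_map_compose[OF c[of 2], of euclidean "\<lambda>z. \<i> * z"]
        by (simp add: o_def continuous_intros)
      have "continuous_map (nsphere 2) euclidean (\<lambda>x. complex_of_real (x 1) + \<i> * complex_of_real (x 2))"
        by (intro continuous_map_add c m)
      then show ?thesis
        using continuous_map_nsphere_projection[of 2 0]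
        by (simp add: continuous_map_pairwise o_def flip: euclidean_product_topology prod_topology_euclidean)
    qed
    then show "continuous_map (nsphere 2) euclidean i"
      by (simp add: i_def Complex_eq)
    show "i \<in> topspace (nsphere 2) \<rightarrow> S2"
      by (auto simp: i_def nsphere sum3 norm_Pair cmod_def)
  qed
  have j: "continuous_map (top_of_set S2) (nsphere 2) j"
  proof -
    have "continuous_on S2 (\<lambda>x. j x k)" for k
      unfolding j_def by (cases "k = 0"; cases "k = 1"; cases "k = 2"; simp add: continuous_intros)
    moreover have "j \<in> S2 \<rightarrow> {x. (\<Sum>i\<le>2. x i ^ 2) = 1 \<and> (\<forall>i>2. x i = 0)}"
      unfolding sum3 by (auto simp: j_def norm_Pair cmod_def)
    ultimately show ?thesis
      unfolding nsphere continuous_map_in_subtopology continuous_map_componentwise_UNIV by auto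
  qed
  have "homotopic_with (\<lambda>_. True) (nsphere 2) (nsphere 2) (j \<circ> ((\<lambda>x. x) \<circ> i)) (j \<circ> (refl2 \<circ> i))"
    by (rule homotopic_with_compose_continuous_map_left[OF
          homotopic_with_compose_continuous_map_right[OF hom i] j]) auto
  then have "homotopic_with (\<lambda>_. True) (nsphere 2) (nsphere 2) id (\<lambda>x i. if i = 0 then - x i else x i)"
  proof (rule homotopic_with_eq)
    fix x assume "x \<in> topspace (nsphere 2)"
    then have z: "\<forall>n>2. x n = 0" by (simp add: nsphere)
    have *: "n = 0 \<or> n = 1 \<or> n = 2 \<or> n > 2" for n :: nat by linarith
    show "id x = (j \<circ> ((\<lambda>x. x) \<circ> i)) x"
      using z * by (fastforce simp: j_def i_def fun_eq_iff)
    show "(\<lambda>i. if i = 0 then - x i else x i) = (j \<circ> (refl2 \<circ> i)) x"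
      using z * by (fastforce simp: j_def i_def fun_eq_iff refl2_def)
  qed auto
  then have "Brouwer_degree2 2 id = Brouwer_degree2 2 (\<lambda>x i. if i = 0 then - x i else x i)"
    by (rule Brouwer_degree2_homotopic)
  then show False by (simp add: Brouwer_degree2_reflection)
qed

text \<open>A map commuting with the rotations about the axis is determined by its restriction to one meridian,
which is a path between the poles. The sphere is simply connected, so this path can be deformed to the
meridian itself with its ends fixed, and rotating the deformation gives a homotopy to the identity.\<close>

lemma equivariant_sphere_map_homotopic_identity:
  assumes cont: "continuous_on S2 M" and M: "M \<in> S2 \<rightarrow> S2"
    and eqv: "\<And>h w c. (h, w) \<in> S2 \<Longrightarrow> norm c = 1 \<Longrightarrow> M (h, c * w) = (fst (M (h, w)), c * snd (M (h, w)))"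
    and poles: "M (1, 0) = (1, 0)" "M (-1, 0) = (-1, 0)"
  shows "homotopic_with_canon (\<lambda>_. True) S2 S2 M (\<lambda>x. x)"
proof -
  define mer :: "real \<Rightarrow> real \<times> complex" where "mer = (\<lambda>t. (cos (pi * t), of_real (sin (pi * t))))"
  have mer_S: "mer t \<in> S2" for t
    unfolding mer_def S2_iff by simp
  have mer_cont: "continuous_on T mer" for T
    unfolding mer_def by (intro continuous_intros)
  have "simply_connected S2"
    by (rule simply_connected_sphere) simp
  moreover have "path mer" "path (M \<circ> mer)"
    unfolding path_def
    by (rule mer_cont)
      (rule continuous_on_compose[OF mer_cont continuous_on_subset[OF cont]], use mer_S in blast)
  moreover have "path_image mer \<subseteq> S2" "path_image (M \<circ> mer) \<subseteq> S2"
    using mer_S M by (auto simp: path_image_def)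
  moreover have "pathstart mer = pathstart (M \<circ> mer)" "pathfinish mer = pathfinish (M \<circ> mer)"
    using poles by (auto simp: pathstart_def pathfinish_def mer_def)
  ultimately have "homotopic_paths S2 (M \<circ> mer) mer"
    unfolding simply_connected_eq_homotopic_paths by blast
  then obtain H where Hc: "continuous_on ({0..1} \<times> {0..1}) H" and HS: "H \<in> {0..1} \<times> {0..1} \<rightarrow> S2"
    and H0: "\<forall>t\<in>{0..1}. H (0, t) = (M \<circ> mer) t" and H1: "\<forall>t\<in>{0..1}. H (1, t) = mer t"
    and Hends: "\<forall>s\<in>{0..1::real}. pathstart (H \<circ> Pair s) = pathstart (M \<circ> mer)
      \<and> pathfinish (H \<circ> Pair s) = pathfinish (M \<circ> mer)"
    unfolding homotopic_paths by metis
  have Hp: "\<And>s. s \<in> {0..1} \<Longrightarrow> H (s, 0) = (1, 0)" "\<And>s. s \<in> {0..1} \<Longrightarrow> H (s, 1) = (-1, 0)"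
    using Hends poles by (auto simp: pathstart_def pathfinish_def mer_def)
  \<comment> \<open>The parameter at which the meridian has the same height as the given point.\<close>
  define \<tau> :: "real \<Rightarrow> real" where "\<tau> h = arccos h / pi" for h
  have \<tau>: "\<tau> h \<in> {0..1}" "cos (pi * \<tau> h) = h" "sin (pi * \<tau> h) = norm w" if "(h, w) \<in> S2" for h w
  proof -
    have hw: "h\<^sup>2 + (norm w)\<^sup>2 = 1" using that unfolding S2_iff by simp
    then have "h\<^sup>2 \<le> 1" by (smt (verit) zero_le_power2)
    then have h: "-1 \<le> h" "h \<le> 1" using abs_square_le_1[of h] by auto
    then show "\<tau> h \<in> {0..1}" "cos (pi * \<tau> h) = h"
      by (auto simp: \<tau>_def arccos_lbound arccos_ubound)
    have "sin (pi * \<tau> h) = sqrt (1 - h\<^sup>2)" using h by (simp add: \<tau>_def sin_arccos)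
    also have "1 - h\<^sup>2 = (norm w)\<^sup>2" using hw by simp
    finally show "sin (pi * \<tau> h) = norm w" by simp
  qed
  define P where "P = (\<lambda>(s, x :: real \<times> complex). H (s, \<tau> (fst x)))"
  have P_cont: "continuous_on ({0..1} \<times> S2) P"
  proof -
    have ac: "continuous_on ({0..1} \<times> S2) (\<lambda>p. arccos (fst (snd p)))"
    proof (rule continuous_on_compose2[OF continuous_on_arccos'])
      show "continuous_on ({0..1} \<times> S2) (\<lambda>p. fst (snd p))" by (intro continuous_intros)
      show "(\<lambda>p. fst (snd p)) ` ({0..1} \<times> S2) \<subseteq> {-1..1}"
      proof clarify
        fix h w assume "(h, w :: complex) \<in> S2"
        then have "h\<^sup>2 \<le> 1" unfolding S2_iff by (smt (verit) zero_le_power2)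
        then show "fst (snd (s, h, w)) \<in> {-1..1}" for s using abs_square_le_1[of h] by auto
      qed
    qed
    have "continuous_on ({0..1} \<times> S2) (\<lambda>p. (fst p, \<tau> (fst (snd p))))"
      unfolding \<tau>_def by (intro continuous_intros ac) auto
    then show ?thesis
      unfolding P_def case_prod_unfold
      by (rule continuous_on_compose2[OF Hc]) (use \<tau> in auto)
  qed
  have P_S: "P p \<in> S2" if "p \<in> {0..1} \<times> S2" for p
    using that HS \<tau> unfolding P_def by fastforce
  have P_pole: "snd (P (s, h, 0)) = 0" if "s \<in> {0..1}" "(h, 0) \<in> S2" for s h
  proof -
    have "h\<^sup>2 = 1" using that unfolding S2_iff by simp
    then have "h = 1 \<or> h = -1" by (simp add: power2_eq_1_iff)
    then show ?thesis using Hp that by (auto simp: P_def \<tau>_def)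
  qed
  \<comment> \<open>\<open>sgn w\<close> is the rotation taking the meridian to the point \<open>(h, w)\<close>. It is discontinuous at the poles,
    but there it multiplies a quantity that tends to zero.\<close>
  define K where "K = (\<lambda>p. (fst (P p), snd (P p) * sgn (snd (snd p))))"
  have K_cont: "continuous_on ({0..1} \<times> S2) K"
    unfolding continuous_on_eq_continuous_within
  proof
    fix p0 :: "real \<times> real \<times> complex" assume p0: "p0 \<in> {0..1} \<times> S2"
    let ?F = "at p0 within {0..1} \<times> S2"
    have Pl: "(P \<longlongrightarrow> P p0) ?F"
      using P_cont p0 unfolding continuous_on_def by blast
    have sndl: "((\<lambda>p. snd (snd p)) \<longlongrightarrow> snd (snd p0)) ?F" by (intro tendsto_intros)
    have "((\<lambda>p. snd (P p) * sgn (snd (snd p))) \<longlongrightarrow> snd (P p0) * sgn (snd (snd p0))) ?F"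
    proof (cases "snd (snd p0) = 0")
      case False
      then show ?thesis by (intro tendsto_mult tendsto_snd tendsto_sgn Pl sndl)
    next
      case True
      then have 0: "snd (P p0) = 0" using P_pole p0 by (metis mem_Sigma_iff prod.collapse)
      have "((\<lambda>p. norm (snd (P p))) \<longlongrightarrow> norm (snd (P p0))) ?F" by (intro tendsto_intros Pl)
      then have "((\<lambda>p. norm (snd (P p))) \<longlongrightarrow> 0) ?F" using 0 by simp
      then have "((\<lambda>p. snd (P p) * sgn (snd (snd p))) \<longlongrightarrow> 0) ?F"
        by (rule Lim_null_comparison[rotated]) (auto simp: norm_mult norm_sgn)
      then show ?thesis using 0 by simp
    qed
    then show "continuous ?F K"
      unfolding continuous_within K_def by (intro tendsto_Pair tendsto_fst Pl)
  qed
  show ?thesis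
  proof (rule homotopic_canonI[OF K_cont])
    show "K \<in> {0..1} \<times> S2 \<rightarrow> S2"
    proof
      fix p :: "real \<times> real \<times> complex" assume p: "p \<in> {0..1} \<times> S2"
      obtain s h w where shw: "p = (s, h, w)" by (metis surj_pair)
      obtain a b where ab: "P p = (a, b)" by force
      have ab1: "a\<^sup>2 + (norm b)\<^sup>2 = 1" using P_S[OF p] unfolding ab S2_iff .
      show "K p \<in> S2"
      proof (cases "w = 0")
        case True
        have "snd (P (s, h, 0)) = 0"
          by (rule P_pole) (use p shw True in \<open>simp_all only: mem_Sigma_iff\<close>)
        then have "b = 0" using True ab shw by simp
        then show ?thesis using ab1 by (simp add: K_def ab norm_Pair)
      next
        case False
        then show ?thesis using ab1 ab by (simp add: K_def norm_Pair shw norm_mult norm_sgn)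
      qed
    qed
  next
    fix x assume x: "x \<in> S2"
    obtain h w where hw: "x = (h, w)" by force
    have t: "\<tau> h \<in> {0..1}" "mer (\<tau> h) = (h, of_real (norm w))"
      using \<tau> x by (auto simp: mer_def hw)
    show "K (1, x) = x"
      using H1 t by (simp add: K_def P_def hw sgn_eq)
    show "K (0, x) = M x"
    proof (cases "w = 0")
      case True
      then have "snd (M x) = 0"
        using P_pole[of 0 h] x t H0 by (simp add: hw P_def)
      moreover have "H (0, \<tau> h) = M x" using H0 t True by (simp add: hw)
      ultimately show ?thesis by (simp add: K_def P_def hw True prod_eq_iff)
    next
      case False
      have "M (h, sgn w * of_real (norm w)) = (fst (M (h, of_real (norm w))), sgn w * snd (M (h, of_real (norm w))))"
        using x False by (intro eqv) (auto simp: hw norm_Pair norm_sgn)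
      moreover have "sgn w * of_real (norm w) = w" using False by (simp add: sgn_eq)
      ultimately show ?thesis using H0 t
        by (simp add: K_def P_def hw mult.commute)
    qed
  qed
qed

section \<open>Quaternion values of words\<close>

type_synonym quat = "complex \<times> complex"

text \<open>The pair \<open>(z, w)\<close> stands for the quaternion \<open>z + w j\<close>, with \<open>j w = cnj w j\<close>. In these coordinates the
conjugations fixing the axis \<open>i\<close> multiply the second component by a complex number of modulus one.\<close>

definition qmul :: "quat \<Rightarrow> quat \<Rightarrow> quat" (infixl "\<star>" 70) where
  "x \<star> y = (fst x * fst y - snd x * cnj (snd y), fst x * snd y + snd x * cnj (fst y))"

definition imag_part :: "quat \<Rightarrow> real \<times> complex" where
  "imag_part x = (Im (fst x), snd x)"

text \<open>The unit quaternion \<open>cos \<theta> + sin \<theta> v\<close> for an axis \<open>v\<close> on the sphere; it acts on space as the rotation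
about \<open>v\<close> by \<open>2 \<theta>\<close>.\<close>

definition rot :: "real \<Rightarrow> real \<times> complex \<Rightarrow> quat" where
  "rot \<theta> v = (Complex (cos \<theta>) (sin \<theta> * fst v), of_real (sin \<theta>) * snd v)"

text \<open>The value of a word when the generator of factor \<open>i\<close> is sent to the quaternion with angle \<open>\<Theta> i\<close> and
axis \<open>U i\<close>. For angles in \<open>\<pi>\<int>\<close> divided by the orders of the factors, words that represent the same
element of the free product have the same value up to sign.\<close>

definition qword :: "(nat \<Rightarrow> real) \<Rightarrow> (nat \<Rightarrow> real \<times> complex) \<Rightarrow> (nat \<times> int) list \<Rightarrow> quat" where
  "qword \<Theta> U u = foldr (\<lambda>(i, a) y. rot (\<Theta> i * of_int a) (U i) \<star> y) u (1, 0)"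

lemma qword_simps [simp]:
  "qword \<Theta> U [] = (1, 0)"
  "qword \<Theta> U ((i, a) # u) = rot (\<Theta> i * of_int a) (U i) \<star> qword \<Theta> U u"
  by (simp_all add: qword_def)

lemma norm_qmul: "norm (x \<star> y) = norm x * norm y"
proof -
  have sq: "(norm z)\<^sup>2 = (norm (fst z))\<^sup>2 + (norm (snd z))\<^sup>2" for z :: quat
    by (simp add: norm_prod_def)
  have "(norm (x \<star> y))\<^sup>2 = (norm x * norm y)\<^sup>2"
    unfolding sq power_mult_distrib qmul_def cmod_power2 by (simp add: power2_eq_square algebra_simps)
  then show ?thesis by (simp add: power2_eq_iff_nonneg)
qed

lemma norm_rot:
  assumes "v \<in> S2" shows "norm (rot \<theta> v) = 1"
proof -
  obtain h w where v: "v = (h, w)" by force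
  have "h\<^sup>2 + (norm w)\<^sup>2 = 1" using assms unfolding v S2_iff .
  then have "(cos \<theta>)\<^sup>2 + (sin \<theta> * h)\<^sup>2 + (sin \<theta> * norm w)\<^sup>2 = (cos \<theta>)\<^sup>2 + (sin \<theta>)\<^sup>2"
    by (metis (no_types, lifting) add.assoc distrib_left mult.right_neutral power_mult_distrib)
  then show ?thesis by (simp add: rot_def v norm_Pair cmod_power2 norm_mult power_mult_distrib)
qed

lemma norm_qword: "(\<And>i. U i \<in> S2) \<Longrightarrow> norm (qword \<Theta> U u) = 1"
  by (induction u) (auto simp: norm_qmul norm_rot norm_Pair simp del: mem_sphere_0)

lemma continuous_on_qword:
  assumes "\<And>i. continuous_on X (\<lambda>x. U x i)"
  shows "continuous_on X (\<lambda>x. qword \<Theta> (U x) u)"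
proof (induction u)
  case (Cons l u)
  obtain i a where l: "l = (i, a)" by force
  have "continuous_on X (\<lambda>x. rot (\<Theta> i * of_int a) (U x i))"
    unfolding rot_def Complex_eq by (intro continuous_intros assms)
  then show ?case
    unfolding l qword_simps qmul_def by (intro continuous_intros Cons.IH)
qed simp

lemma qword_rotate_axes:
  assumes "norm c = 1"
  shows "qword \<Theta> (\<lambda>i. (fst (U i), c * snd (U i))) u = (fst (qword \<Theta> U u), c * snd (qword \<Theta> U u))"
proof (induction u)
  case (Cons l u)
  obtain i a where l: "l = (i, a)" by force
  have "c * cnj c = 1" using assms by (simp add: complex_norm_square[symmetric])
  then show ?case
    unfolding l qword_simps Cons.IH qmul_def rot_def by (simp add: algebra_simps)
qed simp

definition exponent_sum :: "nat \<Rightarrow> (nat \<times> int) list \<Rightarrow> int" where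
  "exponent_sum i u = (\<Sum>(j, a)\<leftarrow>u. if j = i then a else 0)"

lemma qword_parallel_axes:
  assumes "fst ` set u \<subseteq> {0, 1, 2}" "\<And>i. U i = (\<epsilon> i, 0)" "\<And>i. \<epsilon> i = 1 \<or> \<epsilon> i = -1"
  shows "qword \<Theta> U u = (cis (\<Sum>i\<in>{0,1,2}. \<epsilon> i * \<Theta> i * of_int (exponent_sum i u)), 0)"
  using assms(1)
proof (induction u)
  case Nil
  then show ?case by (simp add: exponent_sum_def)
next
  case (Cons l u)
  obtain i a where l: "l = (i, a)" by force
  have "rot (\<Theta> i * of_int a) (U i) = (cis (\<epsilon> i * \<Theta> i * of_int a), 0)"
    using assms(2,3)[of i] by (auto simp: rot_def cis.ctr)
  then have "qword \<Theta> U (l # u) = (cis (\<epsilon> i * \<Theta> i * of_int a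
      + (\<Sum>i\<in>{0,1,2}. \<epsilon> i * \<Theta> i * of_int (exponent_sum i u))), 0)"
    using Cons by (simp add: l qmul_def cis_mult)
  also have "\<epsilon> i * \<Theta> i * of_int a + (\<Sum>i\<in>{0,1,2}. \<epsilon> i * \<Theta> i * of_int (exponent_sum i u))
    = (\<Sum>i\<in>{0,1,2}. \<epsilon> i * \<Theta> i * of_int (exponent_sum i (l # u)))"
    using Cons.prems by (auto simp: l exponent_sum_def algebra_simps)
  finally show ?case .
qed

text \<open>If no choice of axes gave a real value, normalizing the imaginary part along the half circle of second
axes would be a homotopy \<open>N\<close> between a map of the sphere that fixes both poles and a map that exchanges
them, both commuting with the rotations about the first axis. The first one is homotopic to the
identity and the second one to the reflection. The sign conditions say exactly that the poles behave in
this way: with parallel axes the value of the word is \<open>cis\<close> of a signed sum of the angles \<open>x i\<close>.\<close>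

lemma exists_axes_with_real_value:
  fixes u :: "(nat \<times> int) list" and \<Theta> :: "nat \<Rightarrow> real"
  defines "x i \<equiv> \<Theta> i * of_int (exponent_sum i u)"
  assumes u: "fst ` set u \<subseteq> {0, 1, 2}"
    and s1: "sin (x 0 + x 1 + x 2) * sin (x 0 + x 1 - x 2) < 0"
    and s2: "sin (x 0 + x 1 + x 2) * sin (x 0 - x 1 + x 2) < 0"
    and s3: "sin (x 0 + x 1 + x 2) * sin (x 0 - x 1 - x 2) > 0"
  shows "\<exists>U. (\<forall>i. U i \<in> S2) \<and> imag_part (qword \<Theta> U u) = 0"
proof (rule ccontr)
  assume none: "\<not> ?thesis"
  \<comment> \<open>Only the relative signs are prescribed; \<open>\<sigma>\<close> normalizes the sign at three parallel axes.\<close>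
  define \<sigma> where "\<sigma> = - sgn (sin (x 0 + x 1 + x 2))"
  have \<sigma>: "\<bar>\<sigma>\<bar> = 1" using s1 by (auto simp: \<sigma>_def abs_sgn_eq)
  define ax :: "real \<times> (real \<times> complex) \<Rightarrow> nat \<Rightarrow> real \<times> complex" where
    "ax = (\<lambda>p i. if i = 0 then (1, 0) else if i = 1 then (cos (pi * fst p), of_real (sin (pi * fst p))) else snd p)"
  define f where "f p = imag_part (qword \<Theta> (ax p) u)" for p
  define N where "N p = (\<sigma> / norm (f p)) *\<^sub>R f p" for p
  have ax_S: "ax p i \<in> S2" if "snd p \<in> S2" for p i
    using that by (auto simp: ax_def norm_Pair)
  have f0: "f p \<noteq> 0" if "snd p \<in> S2" for p
    using none ax_S[OF that] unfolding f_def by blast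
  have f_cont: "continuous_on X f" for X
  proof -
    have "continuous_on X (\<lambda>p. ax p i)" for i
      unfolding ax_def by (cases "i = 0"; cases "i = 1") (auto intro!: continuous_intros)
    then show ?thesis
      unfolding f_def imag_part_def by (intro continuous_intros continuous_on_qword)
  qed
  have N_cont: "continuous_on ({0..1} \<times> S2) N"
    unfolding N_def using f0 by (intro continuous_intros f_cont) fastforce
  have N_S: "N p \<in> S2" if "snd p \<in> S2" for p
    using f0[OF that] \<sigma> by (simp add: N_def)
  have N_eqv: "N (s, (h, c * w)) = (fst (N (s, (h, w))), c * snd (N (s, (h, w))))"
    if c: "norm c = 1" and s: "s = 0 \<or> s = 1" for s h w c
  proof -
    have "ax (s, (h, c * w)) = (\<lambda>i. (fst (ax (s, (h, w)) i), c * snd (ax (s, (h, w)) i)))"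
      using s by (auto simp: ax_def fun_eq_iff)
    then have "f (s, (h, c * w)) = (fst (f (s, (h, w))), c * snd (f (s, (h, w))))"
      unfolding f_def by (simp add: qword_rotate_axes[OF c] imag_part_def)
    then show ?thesis
      using c by (simp add: N_def norm_prod_def norm_mult scaleR_conv_of_real)
  qed
  have N_pole: "N (s, (\<epsilon>2, 0)) = (\<sigma> * sgn (sin (x 0 + \<epsilon>1 * x 1 + \<epsilon>2 * x 2)), 0)"
    if e: "s = 0 \<and> \<epsilon>1 = 1 \<or> s = 1 \<and> \<epsilon>1 = -1" "\<epsilon>2 = 1 \<or> \<epsilon>2 = -1" for s \<epsilon>1 \<epsilon>2
  proof -
    define \<epsilon> :: "nat \<Rightarrow> real" where "\<epsilon> i = (if i = 0 then 1 else if i = 1 then \<epsilon>1 else \<epsilon>2)" for i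
    have "qword \<Theta> (ax (s, (\<epsilon>2, 0))) u = (cis (\<Sum>i\<in>{0,1,2}. \<epsilon> i * \<Theta> i * of_int (exponent_sum i u)), 0)"
      by (rule qword_parallel_axes[OF u]) (use e in \<open>auto simp: \<epsilon>_def ax_def\<close>)
    then have "f (s, (\<epsilon>2, 0)) = (sin (x 0 + \<epsilon>1 * x 1 + \<epsilon>2 * x 2), 0)"
      by (simp add: f_def imag_part_def \<epsilon>_def x_def add.assoc mult.assoc)
    then show ?thesis by (simp add: N_def norm_Pair sgn_real_def)
  qed
  let ?M0 = "\<lambda>t. N (0, t)" and ?M1 = "\<lambda>t. N (1, t)"
  have cont: "continuous_on S2 (\<lambda>t. N (s, t))" if "s \<in> {0..1}" for s
    by (rule continuous_on_compose2[OF N_cont]) (use that in \<open>auto intro!: continuous_intros\<close>)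
  have h01: "homotopic_with_canon (\<lambda>_. True) S2 S2 ?M0 ?M1"
    by (rule homotopic_canonI[OF N_cont]) (use N_S in auto)
  have h1: "homotopic_with_canon (\<lambda>_. True) S2 S2 ?M1 (\<lambda>x. x)"
  proof (rule equivariant_sphere_map_homotopic_identity)
    show "?M1 (1, 0) = (1, 0)" "?M1 (-1, 0) = (-1, 0)"
      using N_pole[of 1 "-1" 1] N_pole[of 1 "-1" "-1"] s2 s3
      by (auto simp: \<sigma>_def mult_less_0_iff zero_less_mult_iff)
  qed (use cont N_S N_eqv in auto)
  have refl_S: "continuous_map (top_of_set S2) (top_of_set S2) refl2"
    unfolding refl2_def by (auto simp: norm_prod_def intro!: continuous_intros)
  have h0: "homotopic_with_canon (\<lambda>_. True) S2 S2 (\<lambda>t. refl2 (?M0 t)) (\<lambda>x. x)"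
  proof (rule equivariant_sphere_map_homotopic_identity)
    show "refl2 (?M0 (1, 0)) = (1, 0)" "refl2 (?M0 (-1, 0)) = (-1, 0)"
      using N_pole[of 0 1 1] N_pole[of 0 1 "-1"] s1
      by (auto simp: \<sigma>_def mult_less_0_iff zero_less_mult_iff refl2_def)
    show "continuous_on S2 (\<lambda>t. refl2 (?M0 t))"
      unfolding refl2_def by (intro continuous_intros cont) auto
    show "(\<lambda>t. refl2 (?M0 t)) \<in> S2 \<rightarrow> S2"
      using N_S by (auto simp: refl2_def norm_prod_def)
  qed (simp add: N_eqv refl2_def)
  have "homotopic_with_canon (\<lambda>_. True) S2 S2 (refl2 \<circ> (\<lambda>t. refl2 (?M0 t))) (refl2 \<circ> (\<lambda>x. x))"
    by (rule homotopic_with_compose_continuous_map_left[OF h0 refl_S]) auto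
  then have "homotopic_with_canon (\<lambda>_. True) S2 S2 ?M0 refl2"
    by (simp add: o_def refl2_def[abs_def])
  then have "homotopic_with_canon (\<lambda>_. True) S2 S2 (\<lambda>x. x) refl2"
    using homotopic_with_trans homotopic_with_symD h01 h1 by blast
  then show False using identity_not_homotopic_to_reflection by blast
qed

text \<open>\<open>\<pi> * near_half p\<close> is the largest multiple of \<open>\<pi>/p\<close> not exceeding \<open>\<pi>/2\<close>. Three such lengths, for
distinct primes, are the sides of a spherical triangle whose perimeter exceeds \<open>\<pi>\<close>; this is where distinctness
enters the choice of angles.\<close>

definition near_half :: "nat \<Rightarrow> real" where
  "near_half p = real (p div 2) / real p"

lemma near_half_bounds:
  assumes "prime p"
  shows "1/3 \<le> near_half p" "near_half p \<le> 1/2" "p \<noteq> 3 \<Longrightarrow> 2/5 \<le> near_half p" "p = 2 \<Longrightarrow> near_half p = 1/2"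
proof -
  have p: "p \<ge> 2" using assms by (rule prime_ge_2_nat)
  show "p = 2 \<Longrightarrow> near_half p = 1/2" by (simp add: near_half_def)
  show "near_half p \<le> 1/2" using p by (simp add: near_half_def field_simps)
  have "p \<noteq> 4" using assms by auto
  then have "p = 2 \<or> p = 3 \<or> p \<ge> 5" using p by linarith
  then have "p \<le> 3 * (p div 2)" by auto
  then have "real p \<le> 3 * real (p div 2)" by linarith
  then show "1/3 \<le> near_half p" using p by (simp add: near_half_def field_simps)
  assume "p \<noteq> 3"
  then have "p = 2 \<or> p \<ge> 5" using \<open>p = 2 \<or> p = 3 \<or> p \<ge> 5\<close> by auto
  then have "2 * p \<le> 5 * (p div 2)" by auto
  then have "2 * real p \<le> 5 * real (p div 2)" by linarith
  then show "2/5 \<le> near_half p" using p by (simp add: near_half_def field_simps)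
qed

lemma exists_multiple_near_half:
  assumes "prime p" "\<not> int p dvd m"
  shows "\<exists>k l::int. real_of_int (m * k) / p = near_half p + l"
proof -
  have "coprime m (int p)" using assms prime_imp_coprime[of "int p" m] by (simp add: coprime_commute)
  then obtain n where "[m * n = 1] (mod int p)" using cong_solve_coprime_int by blast
  then have "[m * n * int (p div 2) = 1 * int (p div 2)] (mod int p)" by (rule cong_scalar_right)
  then have "int p dvd m * n * int (p div 2) - int (p div 2)" by (simp add: cong_iff_dvd_diff)
  then obtain l where "m * n * int (p div 2) - int (p div 2) = int p * l" by (rule dvdE)
  then have "m * n * int (p div 2) = int (p div 2) + int p * l" by simp
  then have "real_of_int (m * (n * int (p div 2))) = real (p div 2) + real p * of_int l"
    by (metis (mono_tags, lifting) mult.assoc of_int_add of_int_mult of_int_of_nat_eq)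
  then have "real_of_int (m * (n * int (p div 2))) / p = near_half p + l"
    using prime_gt_0_nat[OF assms(1)] by (simp add: near_half_def add_divide_distrib del: of_int_mult)
  then show ?thesis by blast
qed

lemma sin_pi_shift: "sin (pi * (r + of_int n)) = sin (pi * r) * cos (pi * of_int n)"
  by (simp add: distrib_left sin_add sin_times_pi_eq_0 mult.commute[of pi "of_int n"])

text \<open>If some exponent sum of \<open>u\<close> is divisible by the order of its factor, a rotation group with a single axis
already kills \<open>u\<close> while keeping that factor nontrivial. Otherwise each exponent sum is a unit modulo
the order of its factor, and the angles can be chosen so that the total angle contributed by factor \<open>i\<close> is \<open>\<pi> * near_half (P i)\<close> up to a multiple
of \<open>\<pi>\<close>; such multiples change all four sines by a common sign.\<close>

lemma exists_rotations_killing_word: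
  fixes P :: "nat \<Rightarrow> nat"
  assumes P: "\<And>i. i \<in> {0,1,2} \<Longrightarrow> prime (P i)" and dist: "P 0 \<noteq> P 1" "P 0 \<noteq> P 2" "P 1 \<noteq> P 2"
    and u: "fst ` set u \<subseteq> {0, 1, 2}"
  shows "\<exists>(\<Theta> :: nat \<Rightarrow> real) U. (\<forall>i. U i \<in> S2) \<and> (\<forall>i\<in>{0,1,2}. \<exists>k::int. \<Theta> i * P i = pi * k)
    \<and> imag_part (qword \<Theta> U u) = 0 \<and> (\<exists>i\<in>{0,1,2}. sin (\<Theta> i) \<noteq> 0)"
proof (cases "\<exists>i\<in>{0,1,2}. int (P i) dvd exponent_sum i u")
  case True
  then obtain i k where i: "i \<in> {0,1,2}" and k: "exponent_sum i u = int (P i) * k" by (blast elim: dvdE)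
  define \<Theta> where "\<Theta> j = (if j = i then pi / P i else 0)" for j
  have Pi: "P i \<ge> 2" using P[OF i] by (rule prime_ge_2_nat)
  have "qword \<Theta> (\<lambda>_. (1, 0)) u = (cis (\<Sum>j\<in>{0,1,2}. 1 * \<Theta> j * of_int (exponent_sum j u)), 0)"
    by (rule qword_parallel_axes[OF u]) auto
  also have "(\<Sum>j\<in>{0,1,2}. 1 * \<Theta> j * of_int (exponent_sum j u)) = of_int k * pi"
    using i Pi k by (auto simp: \<Theta>_def)
  finally have "imag_part (qword \<Theta> (\<lambda>_. (1, 0)) u) = 0"
    by (simp add: imag_part_def zero_prod_def sin_zero_iff_int2)
  moreover have "sin (\<Theta> i) \<noteq> 0"
  proof -
    have "pi / real (P i) < pi" using Pi by (simp add: field_simps)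
    moreover have "pi / real (P i) > 0" using Pi by simp
    ultimately show ?thesis using sin_gt_zero[of "pi / real (P i)"] by (auto simp: \<Theta>_def)
  qed
  moreover have "\<exists>k::int. \<Theta> j * P j = pi * k" for j
    using Pi by (cases "j = i") (auto simp: \<Theta>_def intro: exI[of _ 1] exI[of _ 0])
  ultimately show ?thesis
    using i by (intro exI[of _ \<Theta>] exI[of _ "\<lambda>_. (1, 0)"]) (auto simp: norm_Pair)
next
  case False
  have "\<forall>i\<in>{0,1,2}. \<exists>k l::int. real_of_int (exponent_sum i u * k) / P i = near_half (P i) + l"
    using exists_multiple_near_half P False by blast
  then obtain k l :: "nat \<Rightarrow> int" where
    kl: "\<And>i. i \<in> {0,1,2} \<Longrightarrow> real_of_int (exponent_sum i u * k i) / P i = near_half (P i) + l i"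
    by metis
  define \<Theta> where "\<Theta> i = pi * k i / P i" for i
  define x where "x i = \<Theta> i * of_int (exponent_sum i u)" for i
  define r where "r i = near_half (P i)" for i
  have x: "x i = pi * (r i + l i)" if "i \<in> {0,1,2}" for i
  proof -
    have "x i = pi * (real_of_int (exponent_sum i u * k i) / P i)" by (simp add: x_def \<Theta>_def)
    then show ?thesis unfolding kl[OF that] r_def .
  qed
  have b: "1/3 \<le> r 0" "1/3 \<le> r 1" "1/3 \<le> r 2" "r 0 \<le> 1/2" "r 1 \<le> 1/2" "r 2 \<le> 1/2"
    using near_half_bounds(1,2) P by (auto simp: r_def)
  have sum: "r 0 + r 1 + r 2 > 1"
    using near_half_bounds[OF P, of 0] near_half_bounds[OF P, of 1] near_half_bounds[OF P, of 2] dist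
    unfolding r_def[symmetric] by (cases "P 0 = 3"; cases "P 1 = 3"; cases "P 2 = 3"; simp)
  have neg: "sin (pi * (r 0 + r 1 + r 2)) < 0"
  proof (rule sin_lt_zero)
    show "pi < pi * (r 0 + r 1 + r 2)" using sum by simp
    show "pi * (r 0 + r 1 + r 2) < 2 * pi" using b by simp
  qed
  have pos: "sin (pi * t) > 0" if "0 < t" "t < 1" for t
    using that by (intro sin_gt_zero) auto
  have signs: "sin (pi * (r 0 + r 1 - r 2)) > 0" "sin (pi * (r 0 - r 1 + r 2)) > 0"
    using b by (auto intro!: pos)
  have "sin (pi * (r 1 + r 2 - r 0)) > 0" using b by (auto intro!: pos)
  then have sign3: "sin (pi * (r 0 - r 1 - r 2)) < 0"
    using sin_minus[of "pi * (r 1 + r 2 - r 0)"] by (simp add: algebra_simps)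
  define C where "C = cos (pi * of_int (l 0 + l 1 + l 2))"
  have C: "C * C > 0"
    unfolding C_def cos_npi_int by simp
  have cosC: "cos (pi * of_int (l 0 + l 1 + l 2 - 2 * n)) = C" for n
    unfolding C_def cos_npi_int by simp
  have sinx: "sin (x 0 + x 1 + x 2) = sin (pi * (r 0 + r 1 + r 2)) * C"
    "sin (x 0 + x 1 - x 2) = sin (pi * (r 0 + r 1 - r 2)) * C"
    "sin (x 0 - x 1 + x 2) = sin (pi * (r 0 - r 1 + r 2)) * C"
    "sin (x 0 - x 1 - x 2) = sin (pi * (r 0 - r 1 - r 2)) * C"
    using sin_pi_shift[of "r 0 + r 1 + r 2" "l 0 + l 1 + l 2 - 2 * 0"]
      sin_pi_shift[of "r 0 + r 1 - r 2" "l 0 + l 1 + l 2 - 2 * l 2"]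
      sin_pi_shift[of "r 0 - r 1 + r 2" "l 0 + l 1 + l 2 - 2 * l 1"]
      sin_pi_shift[of "r 0 - r 1 - r 2" "l 0 + l 1 + l 2 - 2 * (l 1 + l 2)"]
    unfolding cosC by (simp_all add: x algebra_simps)
  have rearr: "a * C * (b * C) = a * b * (C * C)" for a b by simp
  have "\<exists>U. (\<forall>i. U i \<in> S2) \<and> imag_part (qword \<Theta> U u) = 0"
    using exists_axes_with_real_value[OF u, of \<Theta>] C neg signs sign3
    unfolding x_def[symmetric] sinx rearr
    by (simp add: mult_less_0_iff zero_less_mult_iff)
  moreover have "\<exists>n::int. \<Theta> i * P i = pi * n" if "i \<in> {0,1,2}" for i
    using prime_gt_0_nat[OF P[OF that]] by (auto simp: \<Theta>_def)
  moreover have "sin (\<Theta> 0) \<noteq> 0"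
  proof
    assume "sin (\<Theta> 0) = 0"
    then obtain n where "\<Theta> 0 = of_int n * pi" by (auto simp: sin_zero_iff_int2)
    then have "x 0 = pi * of_int (n * exponent_sum 0 u)" by (simp add: x_def)
    then have "r 0 = of_int (n * exponent_sum 0 u - l 0)" using x[of 0] by simp
    then have "0 < n * exponent_sum 0 u - l 0" "n * exponent_sum 0 u - l 0 < 1" using b by linarith+
    then show False by simp
  qed
  ultimately show ?thesis by blast
qed

section \<open>Finite unions of normal subgroups\<close>

definition maximal_normal :: "('a, 'm) monoid_scheme \<Rightarrow> 'a set \<Rightarrow> bool" where
  "maximal_normal G M \<longleftrightarrow> M \<lhd> G \<and> M \<noteq> carrier G \<and> (\<forall>N. N \<lhd> G \<longrightarrow> M \<subseteq> N \<longrightarrow> N = M \<or> N = carrier G)"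

context group
begin

lemma commutator_in_normal_left:
  assumes "N \<lhd> G" "x \<in> N" "y \<in> carrier G" shows "x \<otimes> y \<otimes> inv x \<otimes> inv y \<in> N"
proof -
  interpret N: normal N G by fact
  have x: "x \<in> carrier G" using assms N.subset by blast
  have "y \<otimes> inv x \<otimes> inv y \<in> N" using assms by (intro N.inv_op_closed2) auto
  then have "x \<otimes> (y \<otimes> inv x \<otimes> inv y) \<in> N" using assms by auto
  then show ?thesis using x assms by (simp add: m_assoc)
qed

lemma commutator_in_normal_right:
  assumes "N \<lhd> G" "x \<in> carrier G" "y \<in> N" shows "x \<otimes> y \<otimes> inv x \<otimes> inv y \<in> N"
proof -
  interpret N: normal N G by fact
  have "x \<otimes> y \<otimes> inv x \<in> N" using assms by (intro N.inv_op_closed2) auto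
  then show ?thesis using assms by auto
qed

lemma rcos_eq_iff:
  assumes "M \<lhd> G" "x \<in> carrier G" "y \<in> carrier G"
  shows "M #> x = M #> y \<longleftrightarrow> x \<otimes> inv y \<in> M"
proof -
  interpret M: normal M G by fact
  have "x \<otimes> inv y \<in> M \<longleftrightarrow> x \<in> M #> y"
    using M.rcos_module[OF is_group] assms by simp
  also have "\<dots> \<longleftrightarrow> M #> x = M #> y"
    using repr_independence[OF _ assms(3) M.subgroup_axioms] rcos_self[OF assms(2) M.subgroup_axioms] by metis
  finally show ?thesis by simp
qed

text \<open>Both \<open>A M\<close> and \<open>B M\<close> are the whole group, so any commutator is congruent modulo \<open>M\<close> to a commutator of
an element of \<open>A\<close> with one of \<open>B\<close>, and those lie in \<open>A \<inter> B\<close>.\<close>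

lemma derived_le_maximal_normal:
  assumes M: "maximal_normal G M" and A: "A \<lhd> G" "\<not> A \<subseteq> M" and B: "B \<lhd> G" "\<not> B \<subseteq> M"
    and AB: "A \<inter> B \<subseteq> M"
  shows "derived G (carrier G) \<subseteq> M"
proof -
  have MG: "M \<lhd> G" using M unfolding maximal_normal_def by (rule conjunct1)
  interpret M: normal M G by fact
  have full: "M <#> C = carrier G" if C: "C \<lhd> G" "\<not> C \<subseteq> M" for C
  proof -
    interpret C: normal C G by fact
    have "M \<subseteq> M <#> C"
    proof
      fix m assume "m \<in> M"
      then have "m \<otimes> \<one> \<in> M <#> C"
        unfolding set_mult_def UN_iff singleton_iff using C.one_closed by blast
      then show "m \<in> M <#> C" using \<open>m \<in> M\<close> M.subset by auto
    qed
    moreover have "C \<subseteq> M <#> C"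
    proof
      fix c assume "c \<in> C"
      then have "\<one> \<otimes> c \<in> M <#> C"
        unfolding set_mult_def UN_iff singleton_iff using M.one_closed by blast
      then show "c \<in> M <#> C" using \<open>c \<in> C\<close> C.subset by auto
    qed
    ultimately show ?thesis
      using M normal_subgroup_set_mult_closed[OF MG C(1)] C(2) unfolding maximal_normal_def by metis
  qed
  interpret A: normal A G by fact
  interpret B: normal B G by fact
  have "x \<otimes> y \<otimes> inv x \<otimes> inv y \<in> M" if x: "x \<in> carrier G" and y: "y \<in> carrier G" for x y
  proof -
    have "x \<in> M <#> A" "y \<in> M <#> B" using full[OF A] full[OF B] x y by simp_all
    then obtain m a n b where a: "m \<in> M" "a \<in> A" "x = m \<otimes> a"
      and b: "n \<in> M" "b \<in> B" "y = n \<otimes> b"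
      unfolding set_mult_def by blast
    have c: "a \<in> carrier G" "b \<in> carrier G" "m \<in> carrier G" "n \<in> carrier G"
      using a b A.subset B.subset M.subset by auto
    have X: "M #> x = M #> a" "M #> y = M #> b"
      using a b c x y by (simp_all add: rcos_eq_iff[OF MG] m_assoc)
    have "a \<otimes> b \<otimes> inv a \<otimes> inv b \<in> M"
      using AB commutator_in_normal_left[OF A(1) a(2) c(2)] commutator_in_normal_right[OF B(1) c(1) b(2)] by blast
    then have ab: "M #> (a \<otimes> b) = M #> (b \<otimes> a)"
      using c by (simp add: rcos_eq_iff[OF MG] inv_mult_group m_assoc)
    have "M #> (x \<otimes> y) = (M #> x) <#> (M #> y)" using x y by (simp add: M.rcos_sum)
    also have "\<dots> = M #> (a \<otimes> b)" using c by (simp add: X M.rcos_sum)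
    also have "\<dots> = (M #> y) <#> (M #> x)" using c by (simp add: ab X M.rcos_sum)
    also have "\<dots> = M #> (y \<otimes> x)" using x y by (simp add: M.rcos_sum)
    finally show ?thesis using x y by (simp add: rcos_eq_iff[OF MG] inv_mult_group m_assoc)
  qed
  then have "derived_set G (carrier G) \<subseteq> M" by auto
  then show ?thesis unfolding derived_def using M.is_subgroup by (rule generate_subgroup_incl)
qed

text \<open>A maximal normal subgroup with nonabelian quotient behaves like a prime ideal, hence does not contain
the intersection of finitely many normal subgroups none of which it contains.\<close>

lemma normal_below_family_not_below_maximal:
  assumes M: "maximal_normal G M" and D: "\<not> derived G (carrier G) \<subseteq> M"
    and F: "finite F" "\<And>N. N \<in> F \<Longrightarrow> N \<lhd> G \<and> \<not> N \<subseteq> M"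
  shows "\<exists>E. E \<lhd> G \<and> E \<subseteq> derived G (carrier G) \<and> (\<forall>N\<in>F. E \<subseteq> N) \<and> \<not> E \<subseteq> M"
  using F
proof (induction F)
  case empty
  then show ?case using D derived_self_is_normal by blast
next
  case (insert N F)
  then obtain E where E: "E \<lhd> G" "E \<subseteq> derived G (carrier G)" "\<forall>N\<in>F. E \<subseteq> N" "\<not> E \<subseteq> M" by auto
  have N: "N \<lhd> G" "\<not> N \<subseteq> M" using insert.prems by auto
  have "\<not> E \<inter> N \<subseteq> M"
  proof
    assume "E \<inter> N \<subseteq> M"
    from derived_le_maximal_normal[OF M E(1,4) N this] D show False by contradiction
  qed
  then show ?case
  proof (intro exI[of _ "E \<inter> N"] conjI ballI)
    show "E \<inter> N \<lhd> G" by (rule normal_subgroup_intersect[OF E(1) N(1)])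
    show "E \<inter> N \<subseteq> derived G (carrier G)" using E(2) by blast
    show "E \<inter> N \<subseteq> K" if "K \<in> insert N F" for K using E(3) that by blast
  qed (rule \<open>\<not> E \<inter> N \<subseteq> M\<close>)
qed

text \<open>Induction on the family. If the element found for the others falls into \<open>M\<close>, then \<open>M\<close> has a nonabelian
quotient: otherwise it would contain \<open>d\<close>, hence \<open>g\<close>, which the hypothesis on \<open>g\<close> excludes. Multiplying by an element of the derived group that lies in
all the others but not in \<open>M\<close> moves the element out of \<open>M\<close> and keeps it out of the others.\<close>

lemma exists_in_coset_of_derived_avoiding:
  assumes g: "g \<in> carrier G" and gen: "\<And>N. N \<lhd> G \<Longrightarrow> derived G (carrier G) \<subseteq> N \<Longrightarrow> g \<in> N \<Longrightarrow> N = carrier G"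
    and F: "finite F" "\<And>M. M \<in> F \<Longrightarrow> maximal_normal G M"
  shows "\<exists>d\<in>derived G (carrier G). \<forall>M\<in>F. g \<otimes> d \<notin> M"
  using F
proof (induction F)
  case empty
  then show ?case using derived_is_subgroup[of "carrier G"] by (auto dest: subgroup.one_closed)
next
  case (insert M F)
  let ?D = "derived G (carrier G)"
  have D: "subgroup ?D G" by (rule derived_is_subgroup) simp
  obtain d where d: "d \<in> ?D" "\<And>N. N \<in> F \<Longrightarrow> g \<otimes> d \<notin> N" using insert by auto
  have dc: "d \<in> carrier G" using d(1) subgroup.subset[OF D] by blast
  have M: "maximal_normal G M" "M \<lhd> G" "M \<noteq> carrier G" using insert.prems by (auto simp: maximal_normal_def)
  interpret M: normal M G by (rule M(2))
  show ?case
  proof (cases "g \<otimes> d \<in> M")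
    case False
    then show ?thesis using d by (intro bexI[of _ d]) auto
  next
    case True
    have ncomm: "\<not> ?D \<subseteq> M"
    proof
      assume DM: "?D \<subseteq> M"
      then have "g \<otimes> d \<otimes> inv d \<in> M" using True d by auto
      then have "g \<in> M" using g dc by (simp add: m_assoc)
      then show False using gen[OF M(2) DM] M(3) by blast
    qed
    have "N \<lhd> G \<and> \<not> N \<subseteq> M" if "N \<in> F" for N
      using insert.prems(1)[of N] insert.hyps(2) that M unfolding maximal_normal_def by auto
    from normal_below_family_not_below_maximal[OF M(1) ncomm insert.hyps(1) this] obtain E where
      E: "E \<lhd> G" "E \<subseteq> ?D" "\<And>N. N \<in> F \<Longrightarrow> E \<subseteq> N" "\<not> E \<subseteq> M" by blast
    obtain y where y: "y \<in> E" "y \<notin> M" using E(4) by blast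
    have yc: "y \<in> carrier G" using y(1) E(2) subgroup.subset[OF D] by blast
    have dy: "d \<otimes> y \<in> ?D" using d(1) y(1) E(2) subgroup.m_closed[OF D] by blast
    have "g \<otimes> (d \<otimes> y) \<notin> M"
    proof
      assume "g \<otimes> (d \<otimes> y) \<in> M"
      then have "inv (g \<otimes> d) \<otimes> (g \<otimes> (d \<otimes> y)) \<in> M" using True by auto
      moreover have "inv (g \<otimes> d) \<otimes> (g \<otimes> (d \<otimes> y)) = y"
        using g dc yc by (simp add: m_assoc inv_mult_group inv_solve_left')
      ultimately show False using y(2) by simp
    qed
    moreover have "g \<otimes> (d \<otimes> y) \<notin> N" if N: "N \<in> F" for N
    proof
      assume a: "g \<otimes> (d \<otimes> y) \<in> N"
      interpret N: normal N G using insert.prems(1)[of N] N by (simp add: maximal_normal_def)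
      have "y \<in> N" using y(1) E(3)[OF N] by blast
      then have "g \<otimes> (d \<otimes> y) \<otimes> inv y \<in> N" using a by auto
      moreover have "g \<otimes> (d \<otimes> y) \<otimes> inv y = g \<otimes> d" using g dc yc by (simp add: m_assoc)
      ultimately show False using d(2)[OF N] by simp
    qed
    ultimately show ?thesis using dy by blast
  qed
qed

text \<open>A subgroup above \<open>N\<close> is a union of cosets of \<open>N\<close>, so there are only finitely many of them.\<close>

lemma finite_index_le_maximal_normal:
  assumes N: "N \<lhd> G" "N \<noteq> carrier G" "finite (rcosets N)"
  shows "\<exists>M. maximal_normal G M \<and> N \<subseteq> M"
proof -
  let ?K = "{K. K \<lhd> G \<and> N \<subseteq> K \<and> K \<noteq> carrier G}"
  have NG: "subgroup N G" using N(1) by (rule normal_imp_subgroup)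
  have union: "K = \<Union>((\<lambda>x. N #> x) ` K)" if K: "K \<in> ?K" for K
  proof -
    have "subgroup K G" using K normal_imp_subgroup by blast
    then have "N #> x \<subseteq> K" if "x \<in> K" for x
      using K that by (auto simp: r_coset_def intro: subgroup.m_closed)
    moreover have "x \<in> N #> x" if "x \<in> K" for x
      using that \<open>subgroup K G\<close> NG subgroup.subset rcos_self by blast
    ultimately show ?thesis by blast
  qed
  have "?K \<subseteq> Union ` Pow (rcosets N)"
  proof
    fix K assume K: "K \<in> ?K"
    have "K \<subseteq> carrier G" using K normal_imp_subgroup subgroup.subset by blast
    then have "(\<lambda>x. N #> x) ` K \<in> Pow (rcosets N)" by (auto simp: RCOSETS_def)
    then show "K \<in> Union ` Pow (rcosets N)" using union[OF K] by blast
  qed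
  then have "finite ?K" using N(3) by (meson finite_Pow_iff finite_imageI finite_subset)
  then obtain M where "M \<in> ?K" "N \<subseteq> M" "\<And>K. K \<in> ?K \<Longrightarrow> M \<subseteq> K \<Longrightarrow> M = K"
    using finite_has_maximal2[of ?K N] N by auto
  then show ?thesis unfolding maximal_normal_def by (intro exI[of _ M]) blast
qed

lemma not_finite_union_of_proper_normal:
  assumes g: "g \<in> carrier G" and gen: "\<And>N. N \<lhd> G \<Longrightarrow> derived G (carrier G) \<subseteq> N \<Longrightarrow> g \<in> N \<Longrightarrow> N = carrier G"
    and F: "finite F" "F \<subseteq> proper_normal_finite_index_subgroups G"
  shows "carrier G \<noteq> \<Union> F"
proof -
  have "\<forall>N\<in>F. \<exists>M. maximal_normal G M \<and> N \<subseteq> M"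
    using F(2) finite_index_le_maximal_normal unfolding proper_normal_finite_index_subgroups_def by blast
  then obtain m where m: "\<And>N. N \<in> F \<Longrightarrow> maximal_normal G (m N) \<and> N \<subseteq> m N" by metis
  obtain d where d: "d \<in> derived G (carrier G)" "\<forall>M\<in>m ` F. g \<otimes> d \<notin> M"
    using exists_in_coset_of_derived_avoiding[OF g gen, of "m ` F"] F(1) m by blast
  have "g \<otimes> d \<in> carrier G" using g d(1) derived_in_carrier[of "carrier G"] by blast
  moreover have "g \<otimes> d \<notin> \<Union> F" using d(2) m by blast
  ultimately show ?thesis by blast
qed

end

section \<open>Finite quotients of linear groups\<close>

text \<open>Malcev's reduction. Some entry \<open>d\<close> of \<open>\<rho> g - 1\<close> is nonzero; reduce all entries modulo an ideal of finite
index in which \<open>d\<close> does not lie. The elements congruent to the identity form the subgroup \<open>N\<close>; its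
coset of an element depends only on the residues of the entries, of which there are finitely many.\<close>

lemma linear_group_finite_quotient:
  fixes G (structure) and \<rho> :: "'a \<Rightarrow> 'k::{field_char_0} ^ 'n ^ 'n"
  assumes G: "group G" and \<rho>1: "\<rho> \<one>\<^bsub>G\<^esub> = mat 1"
    and \<rho>m: "\<And>x y. x \<in> carrier G \<Longrightarrow> y \<in> carrier G \<Longrightarrow> \<rho> (x \<otimes>\<^bsub>G\<^esub> y) = \<rho> x ** \<rho> y"
    and S: "subring_set S" "\<And>d. d \<in> S \<Longrightarrow> d \<noteq> 0 \<Longrightarrow> finite_residue_inverts S d"
    and ent: "\<And>x i j. x \<in> carrier G \<Longrightarrow> \<rho> x $ i $ j \<in> S"
    and g: "g \<in> carrier G" "\<rho> g \<noteq> mat 1"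
  shows "\<exists>N \<in> proper_normal_finite_index_subgroups G. \<forall>x\<in>carrier G. \<rho> x = mat 1 \<longrightarrow> x \<in> N"
proof -
  interpret group G by fact
  obtain i0 j0 where ij: "\<rho> g $ i0 $ j0 - mat 1 $ i0 $ j0 \<noteq> 0"
    using g(2) by (auto simp: vec_eq_iff)
  define d where "d = \<rho> g $ i0 $ j0 - mat 1 $ i0 $ j0"
  have "d \<in> S" unfolding d_def using ent[OF g(1)] S(1) by (auto simp: mat_def intro!: subring_setD)
  then obtain I e where I: "ideal_of S I" "1 \<notin> I" "finite_quotient S I" and e: "e \<in> S" "d * e - 1 \<in> I"
    using S(2)[of d] ij unfolding finite_residue_inverts_def d_def by blast
  define cg where "cg A B \<longleftrightarrow> (\<forall>i j. A $ i $ j - B $ i $ j \<in> I)" for A B :: "'k^'n^'n"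
  have cg_refl: "cg A A" for A using ideal_ofD(2)[OF I(1)] by (simp add: cg_def)
  have cg_sym: "cg B A" if "cg A B" for A B
    using that ideal_ofD(7)[OF I(1)] unfolding cg_def by (metis minus_diff_eq)
  have cg_trans: "cg A C" if "cg A B" "cg B C" for A B C
    unfolding cg_def
  proof (intro allI)
    fix i j
    have "(A $ i $ j - B $ i $ j) + (B $ i $ j - C $ i $ j) \<in> I"
      using that by (intro ideal_ofD(4)[OF I(1)]) (auto simp: cg_def)
    then show "A $ i $ j - C $ i $ j \<in> I" by simp
  qed
  have cg_mult: "cg (\<rho> x ** A) (\<rho> x ** B)" "cg (A ** \<rho> x) (B ** \<rho> x)" if "cg A B" "x \<in> carrier G" for A B x
  proof -
    have "(\<rho> x ** A) $ i $ j - (\<rho> x ** B) $ i $ j = (\<Sum>k\<in>UNIV. \<rho> x $ i $ k * (A $ k $ j - B $ k $ j))" for i j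
      by (simp add: matrix_matrix_mult_def sum_subtractf right_diff_distrib)
    then show "cg (\<rho> x ** A) (\<rho> x ** B)"
      unfolding cg_def using that ent by (auto simp: cg_def intro!: ideal_of_sum[OF I(1)] ideal_ofD(5)[OF I(1)])
    have "(A ** \<rho> x) $ i $ j - (B ** \<rho> x) $ i $ j = (\<Sum>k\<in>UNIV. (A $ i $ k - B $ i $ k) * \<rho> x $ k $ j)" for i j
      by (simp add: matrix_matrix_mult_def sum_subtractf left_diff_distrib)
    then show "cg (A ** \<rho> x) (B ** \<rho> x)"
      unfolding cg_def using that ent by (auto simp: cg_def intro!: ideal_of_sum[OF I(1)] ideal_ofD(6)[OF I(1)])
  qed
  define N where "N = {x \<in> carrier G. cg (\<rho> x) (mat 1)}"
  have inv1: "\<rho> x ** \<rho> (inv x) = mat 1" "\<rho> (inv x) ** \<rho> x = mat 1" if "x \<in> carrier G" for x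
    using \<rho>m[of x "inv x"] \<rho>m[of "inv x" x] that \<rho>1 by simp_all
  have Nsub: "subgroup N G"
  proof (rule subgroupI)
    show "N \<subseteq> carrier G" by (auto simp: N_def)
    show "N \<noteq> {}" using cg_refl \<rho>1 by (auto simp: N_def intro!: exI[of _ \<one>])
  next
    fix x assume "x \<in> N"
    then have x: "x \<in> carrier G" "cg (\<rho> x) (mat 1)" by (auto simp: N_def)
    have "cg (\<rho> (inv x) ** \<rho> x) (\<rho> (inv x) ** mat 1)" using x by (intro cg_mult) auto
    then show "inv x \<in> N" using x inv1 by (auto simp: N_def intro: cg_sym)
  next
    fix x y assume "x \<in> N" "y \<in> N"
    then have x: "x \<in> carrier G" "cg (\<rho> x) (mat 1)" and y: "y \<in> carrier G" "cg (\<rho> y) (mat 1)" by (auto simp: N_def)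
    have "cg (\<rho> x ** \<rho> y) (\<rho> x ** mat 1)" using x y by (intro cg_mult) auto
    then show "x \<otimes> y \<in> N" using x y \<rho>m cg_trans[OF _ x(2)] by (simp add: N_def)
  qed
  have Nnorm: "N \<lhd> G"
    unfolding normal_inv_iff
  proof (intro conjI ballI Nsub)
    fix x h assume x: "x \<in> carrier G" and "h \<in> N"
    then have h: "h \<in> carrier G" "cg (\<rho> h) (mat 1)" by (auto simp: N_def)
    have "cg (\<rho> x ** \<rho> h ** \<rho> (inv x)) (\<rho> x ** mat 1 ** \<rho> (inv x))" using x h by (intro cg_mult) auto
    then show "x \<otimes> h \<otimes> inv x \<in> N" using x h \<rho>m inv1 by (simp add: N_def)
  qed
  have "g \<notin> N"
  proof
    assume "g \<in> N"
    then have "d \<in> I" by (auto simp: N_def cg_def d_def)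
    then have "d * e - (d * e - 1) \<in> I" using e by (blast intro: ideal_ofD(3,6)[OF I(1)])
    then show False using I(2) by simp
  qed
  then have "N \<noteq> carrier G" using g by blast
  moreover have "finite (rcosets N)"
  proof -
    obtain T where T: "finite T" "\<And>s. s \<in> S \<Longrightarrow> \<exists>t\<in>T. s - t \<in> I"
      using I(3) by (auto simp: finite_quotient_def)
    then obtain rep where rep: "\<And>s. s \<in> S \<Longrightarrow> rep s \<in> T \<and> s - rep s \<in> I" by metis
    define cls where "cls x = (\<lambda>(i, j). rep (\<rho> x $ i $ j))" for x
    have "cls ` carrier G \<subseteq> PiE UNIV (\<lambda>_. T)" using rep ent by (auto simp: cls_def)
    then have fin: "finite (cls ` carrier G)" using T(1) by (meson finite finite_PiE finite_subset)
    have eq: "N #> x = N #> y" if x: "x \<in> carrier G" and y: "y \<in> carrier G" and c: "cls x = cls y" for x y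
    proof -
      have "\<rho> x $ i $ j - \<rho> y $ i $ j \<in> I" for i j
      proof -
        have r: "rep (\<rho> x $ i $ j) = rep (\<rho> y $ i $ j)" using fun_cong[OF c, of "(i, j)"] by (simp add: cls_def)
        have "(\<rho> x $ i $ j - rep (\<rho> x $ i $ j)) - (\<rho> y $ i $ j - rep (\<rho> y $ i $ j)) \<in> I"
          using rep ent x y by (blast intro: ideal_ofD(3)[OF I(1)])
        then show ?thesis using r by simp
      qed
      then have "cg (\<rho> x ** \<rho> (inv y)) (\<rho> y ** \<rho> (inv y))" using y by (intro cg_mult) (auto simp: cg_def)
      then have "x \<otimes> inv y \<in> N" using x y inv1 \<rho>m by (simp add: N_def)
      then show ?thesis using rcos_eq_iff[OF Nnorm x y] by blast
    qed
    have "rcosets N = (\<lambda>c. N #> (SOME x. x \<in> carrier G \<and> cls x = c)) ` cls ` carrier G"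
    proof -
      have "N #> x = N #> (SOME y. y \<in> carrier G \<and> cls y = cls x)" if x: "x \<in> carrier G" for x
        using someI[of "\<lambda>y. y \<in> carrier G \<and> cls y = cls x" x] x eq by metis
      then show ?thesis unfolding RCOSETS_def image_image by auto
    qed
    then show ?thesis using fin by simp
  qed
  moreover have "x \<in> N" if "x \<in> carrier G" "\<rho> x = mat 1" for x
    using that cg_refl by (simp add: N_def)
  ultimately show ?thesis
    using Nnorm unfolding proper_normal_finite_index_subgroups_def by blast
qed

section \<open>Unit quaternions modulo sign as matrices\<close>

text \<open>The usual embedding of the quaternions into the complex two-by-two matrices, with \<open>True\<close> as the first
index.\<close>

definition qmat :: "quat \<Rightarrow> bool \<Rightarrow> bool \<Rightarrow> complex" where
  "qmat x i j = (if i then (if j then fst x else snd x) else (if j then - cnj (snd x) else cnj (fst x)))"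

text \<open>The Kronecker product of \<open>qmat x\<close> with its complex conjugate. It does not see the sign of a quaternion
and separates unit quaternions up to sign, so it turns assignments that satisfy the relations of the
free product up to sign into honest homomorphisms.\<close>

definition qrep :: "quat \<Rightarrow> complex ^ (bool \<times> bool) ^ (bool \<times> bool)" where
  "qrep x = (\<chi> r s. qmat x (fst r) (fst s) * cnj (qmat x (snd r) (snd s)))"

lemma qmat_mult: "qmat (x \<star> y) i j = (\<Sum>k\<in>UNIV. qmat x i k * qmat y k j)"
  by (cases i; cases j) (simp_all add: qmat_def qmul_def UNIV_bool algebra_simps)

lemma qrep_mult: "qrep (x \<star> y) = qrep x ** qrep y"
proof -
  have "qmat (x \<star> y) i j * cnj (qmat (x \<star> y) k l)
    = (\<Sum>m\<in>UNIV. \<Sum>n\<in>UNIV. (qmat x i m * cnj (qmat x k n)) * (qmat y m j * cnj (qmat y n l)))" for i j k l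
    unfolding qmat_mult cnj_sum complex_cnj_mult sum_product by (simp add: mult_ac)
  then show ?thesis
    by (simp add: vec_eq_iff qrep_def matrix_matrix_mult_def sum.cartesian_product case_prod_unfold flip: UNIV_Times_UNIV)
qed

lemma qrep_scale: "c * cnj c = 1 \<Longrightarrow> c \<in> \<real> \<Longrightarrow> qrep (c * z, c * w) = qrep (z, w)"
  by (auto simp: vec_eq_iff qrep_def qmat_def Reals_cnj_iff mult_ac)

lemma qrep_one: "qrep (1, 0) = mat 1"
  by (auto simp: vec_eq_iff qrep_def qmat_def mat_def)

lemma qrep_real:
  assumes "norm x = 1" "imag_part x = 0" shows "qrep x = mat 1"
proof -
  obtain z w where x: "x = (z, w)" by force
  have w: "w = 0" and z: "z \<in> \<real>" using assms(2) by (auto simp: x imag_part_def zero_prod_def complex_is_Real_iff)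
  have "norm z = 1" using assms(1) by (simp add: x w norm_Pair)
  then have "z * cnj z = 1" by (simp add: complex_norm_square[symmetric])
  then show ?thesis using qrep_scale[of z 1 0] z qrep_one by (simp add: x w)
qed

lemma qrep_eq_one_imp_real:
  assumes "qrep x = mat 1" shows "imag_part x = 0"
proof -
  obtain z w where x: "x = (z, w)" by force
  have e: "qrep x $ r $ s = mat 1 $ r $ s" for r s using assms by simp
  have "z * z = 1" using e[of "(True, False)" "(True, False)"] by (simp add: x qrep_def qmat_def mat_def)
  then have z: "z = 1 \<or> z = -1" by (simp add: square_eq_1_iff)
  moreover have "z * cnj w = 0" using e[of "(True, True)" "(True, False)"] by (simp add: x qrep_def qmat_def mat_def)
  ultimately have "w = 0" by auto
  then show ?thesis using z by (auto simp: x imag_part_def zero_prod_def)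
qed

lemma rot_mult:
  assumes "v \<in> S2" shows "rot \<theta> v \<star> rot \<phi> v = rot (\<theta> + \<phi>) v"
proof -
  obtain h w where v: "v = (h, w)" by force
  have "h\<^sup>2 + (norm w)\<^sup>2 = 1" using assms unfolding v S2_iff .
  then have hw: "h * h + Re w * Re w + Im w * Im w = 1" unfolding cmod_power2 by (simp add: power2_eq_square)
  have "cos \<theta> * cos \<phi> - sin \<theta> * sin \<phi> * (h * h + Re w * Re w + Im w * Im w) = cos (\<theta> + \<phi>)"
    unfolding hw by (simp add: cos_add)
  then show ?thesis
    by (simp add: rot_def v qmul_def complex_eq_iff sin_add algebra_simps)
qed

lemma qrep_rot_shift: "qrep (rot (\<theta> + pi * of_int n) v) = qrep (rot \<theta> v)"
proof -
  define c where "c = cos (pi * of_int n)"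
  have c: "c * c = 1" unfolding c_def cos_npi_int by simp
  have "rot (\<theta> + pi * of_int n) v = (of_real c * fst (rot \<theta> v), of_real c * snd (rot \<theta> v))"
    unfolding rot_def c_def by (simp add: sin_add cos_add sin_npi_int complex_eq_iff)
  then show ?thesis
    using qrep_scale[of "of_real c" "fst (rot \<theta> v)" "snd (rot \<theta> v)"] c by (simp flip: of_real_mult)
qed

definition general_linear_group :: "('k::field ^ 'n ^ 'n) monoid" where
  "general_linear_group = \<lparr>carrier = {A. invertible A}, monoid.mult = (**), one = mat 1\<rparr>"

lemma group_general_linear: "group (general_linear_group :: ('k::field ^ 'n ^ 'n) monoid)"
proof (rule groupI)
  fix A :: "'k ^ 'n ^ 'n" assume "A \<in> carrier general_linear_group"
  then obtain B where "A ** B = mat 1" "B ** A = mat 1" by (auto simp: general_linear_group_def invertible_def)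
  then show "\<exists>B\<in>carrier general_linear_group. B \<otimes>\<^bsub>general_linear_group\<^esub> A = \<one>\<^bsub>general_linear_group\<^esub>" by (auto simp: general_linear_group_def invertible_def)
next
  show "\<one>\<^bsub>general_linear_group\<^esub> \<in> carrier (general_linear_group :: ('k ^ 'n ^ 'n) monoid)"
    by (auto simp: general_linear_group_def invertible_def intro: exI[of _ "mat 1"])
qed (simp_all add: general_linear_group_def invertible_mult matrix_mul_assoc)

section \<open>Free products of three cyclic groups of prime order\<close>

text \<open>The rotations killing a word for \<open>x\<close> define, by the universal property, a homomorphism \<open>h\<close> to invertible
matrices with \<open>h x = 1\<close>. It is nontrivial because one of the angles is not a multiple of \<open>\<pi>\<close>, and its
values have entries in the ring generated by the entries for the finitely many letters.\<close>

lemma free_product_elem_in_proper_normal: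
  fixes P :: "nat \<Rightarrow> nat"
  defines "C \<equiv> \<lambda>i. integer_mod_group (P i)"
  defines "G \<equiv> free_product {0, 1, 2} C"
  assumes P: "\<And>i. i \<in> {0,1,2} \<Longrightarrow> prime (P i)" and dist: "P 0 \<noteq> P 1" "P 0 \<noteq> P 2" "P 1 \<noteq> P 2"
    and x: "x \<in> carrier G"
  shows "\<exists>N \<in> proper_normal_finite_index_subgroups G. x \<in> N"
proof -
  let ?I = "{0, 1, 2} :: nat set"
  have grp: "group (C i)" if "i \<in> ?I" for i by (simp add: C_def)
  have Pge: "P i \<ge> 2" if "i \<in> ?I" for i using P[OF that] by (rule prime_ge_2_nat)
  have Ccar: "carrier (C i) = {0..<int (P i)}" if "i \<in> ?I" for i
    using Pge[OF that] by (simp add: C_def carrier_integer_mod_group)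
  obtain u where u: "u \<in> fp_words ?I C" "x = fp_rel ?I C `` {u}"
    by (rule fp_carrierE[OF grp x[unfolded G_def]])
  have uI: "fst ` set u \<subseteq> ?I" using u(1) by (auto simp: fp_words_def)
  obtain \<Theta> :: "nat \<Rightarrow> real" and U where U: "\<And>i. U i \<in> S2"
    and \<Theta>: "\<And>i. i \<in> ?I \<Longrightarrow> \<exists>k::int. \<Theta> i * P i = pi * k"
    and ux: "imag_part (qword \<Theta> U u) = 0" and ntriv: "\<exists>i\<in>?I. sin (\<Theta> i) \<noteq> 0"
    using exists_rotations_killing_word[OF P dist uI] by blast
  define f where "f i a = qrep (rot (\<Theta> i * of_int a) (U i))" for i a
  have qinv: "qrep (rot \<theta> (U i)) ** qrep (rot (-\<theta>) (U i)) = mat 1" for \<theta> i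
  proof -
    have "qrep (rot \<theta> (U i)) ** qrep (rot (-\<theta>) (U i)) = qrep (rot (\<theta> + - \<theta>) (U i))"
      unfolding qrep_mult[symmetric] rot_mult[OF U] ..
    also have "rot (\<theta> + - \<theta>) (U i) = (1, 0)" by (simp add: rot_def complex_eq_iff)
    finally show ?thesis by (simp add: qrep_one)
  qed
  have f_hom: "f i \<in> hom (C i) general_linear_group" if i: "i \<in> ?I" for i
  proof (rule homI)
    fix a
    show "f i a \<in> carrier general_linear_group"
      using qinv[of "\<Theta> i * of_int a" i] qinv[of "- (\<Theta> i * of_int a)" i]
      unfolding general_linear_group_def f_def invertible_def by auto
  next
    fix a b
    obtain k :: int where k: "\<Theta> i * P i = pi * k" using \<Theta>[OF i] by blast
    \<comment> \<open>Reducing an exponent modulo the order changes the angle by a multiple of \<open>\<pi>\<close>, hence the quaternion by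
      a sign.\<close>
    define n where "n = (a + b) div int (P i)"
    have "a + b = (a + b) mod int (P i) + int (P i) * n" by (simp add: n_def)
    then have "of_int (a + b) = (of_int ((a + b) mod int (P i)) + real (P i) * of_int n)"
      by (metis of_int_add of_int_mult of_int_of_nat_eq)
    then have "\<Theta> i * of_int (a + b) = \<Theta> i * of_int ((a + b) mod int (P i)) + \<Theta> i * P i * of_int n"
      by (simp only: distrib_left mult.assoc)
    also have "\<Theta> i * P i * of_int n = pi * of_int (k * n)" by (simp add: k)
    finally have eq: "\<Theta> i * of_int a + \<Theta> i * of_int b = \<Theta> i * of_int ((a + b) mod int (P i)) + pi * of_int (k * n)"
      by (simp add: distrib_left)
    have "f i a ** f i b = f i ((a + b) mod int (P i))"
      unfolding f_def qrep_mult[symmetric] rot_mult[OF U] eq qrep_rot_shift ..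
    then show "f i (a \<otimes>\<^bsub>C i\<^esub> b) = f i a \<otimes>\<^bsub>general_linear_group\<^esub> f i b"
      by (simp add: C_def general_linear_group_def)
  qed
  obtain h where h: "h \<in> hom G general_linear_group" and hf0: "\<forall>i\<in>?I. \<forall>a\<in>carrier (C i). h (fp_incl ?I C i a) = f i a"
    using free_product_universal[of ?I C general_linear_group f, OF grp group_general_linear f_hom] unfolding G_def by auto
  have hf: "h (fp_incl ?I C i a) = f i a" if "i \<in> ?I" "a \<in> carrier (C i)" for i a
    using hf0 that by blast
  have G: "group G" unfolding G_def by (rule group_free_product[OF grp])
  have h1: "h \<one>\<^bsub>G\<^esub> = mat 1"
    using hom_one[OF h G group_general_linear] by (simp add: general_linear_group_def)
  have hm: "h (y \<otimes>\<^bsub>G\<^esub> z) = h y ** h z" if "y \<in> carrier G" "z \<in> carrier G" for y z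
    using hom_mult[OF h that] by (simp add: general_linear_group_def)
  have incl_car: "fp_incl ?I C i a \<in> carrier G" if "i \<in> ?I" "a \<in> carrier (C i)" for i a
    unfolding fp_incl_def G_def by (rule fp_carrierI[OF grp]) (use that in auto)
  have cons: "fp_rel ?I C `` {(i, a) # v} = fp_incl ?I C i a \<otimes>\<^bsub>G\<^esub> (fp_rel ?I C `` {v})"
    if "i \<in> ?I" "a \<in> carrier (C i)" "v \<in> fp_words ?I C" for i a v
    unfolding fp_incl_def G_def using fp_mult[of ?I C "[(i, a)]" v, OF grp] that by simp
  have hw: "h (fp_rel ?I C `` {v}) = qrep (qword \<Theta> U v)" if "v \<in> fp_words ?I C" for v
    using that
  proof (induction v)
    case Nil
    then show ?case using h1 by (simp add: G_def free_product_def qrep_one)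
  next
    case (Cons l v)
    obtain i a where l: "l = (i, a)" by force
    have ia: "i \<in> ?I" "a \<in> carrier (C i)" "v \<in> fp_words ?I C" using Cons.prems l by auto
    have v: "fp_rel ?I C `` {v} \<in> carrier G" unfolding G_def by (rule fp_carrierI[OF grp ia(3)])
    have "h (fp_rel ?I C `` {l # v}) = h (fp_incl ?I C i a) ** h (fp_rel ?I C `` {v})"
      unfolding l cons[OF ia] by (rule hm[OF incl_car[OF ia(1,2)] v])
    also have "\<dots> = f i a ** qrep (qword \<Theta> U v)"
      unfolding hf[OF ia(1,2)] Cons.IH[OF ia(3)] ..
    finally show ?case by (simp add: l f_def qrep_mult)
  qed
  define X where "X = (\<lambda>(i, a, r, s). f i a $ r $ s) ` (SIGMA i:?I. carrier (C i) \<times> UNIV)"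
  have "finite X" unfolding X_def by (intro finite_imageI finite_SigmaI) (auto simp: Ccar)
  then obtain S where S: "subring_set S" "X \<subseteq> S" "\<And>d. d \<in> S \<Longrightarrow> d \<noteq> 0 \<Longrightarrow> finite_residue_inverts S d"
    using finitely_generated_subring_inverts by metis
  have SS: "ideal_of S S" by (rule ideal_of_self[OF S(1)])
  have ent_word: "qrep (qword \<Theta> U v) $ r $ s \<in> S" if "v \<in> fp_words ?I C" for v r s
    using that
  proof (induction v arbitrary: r s)
    case Nil
    then show ?case using subring_setD(1,2)[OF S(1)] by (simp add: qrep_one mat_def)
  next
    case (Cons l v)
    obtain i a where l: "l = (i, a)" by force
    have ia: "i \<in> ?I" "a \<in> carrier (C i)" "v \<in> fp_words ?I C" using Cons.prems l by auto
    have "f i a $ r $ t \<in> X" for t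
      unfolding X_def by (rule image_eqI[of _ _ "(i, a, r, t)"]) (use ia in simp_all)
    then have "f i a $ r $ t \<in> S" for t using S(2) by blast
    then have "(\<Sum>t\<in>UNIV. f i a $ r $ t * qrep (qword \<Theta> U v) $ t $ s) \<in> S"
      using Cons.IH[OF ia(3)] by (intro ideal_of_sum[OF SS] subring_setD(4)[OF S(1)]) auto
    then show ?case by (simp add: l qrep_mult f_def matrix_matrix_mult_def)
  qed
  have ent: "h y $ r $ s \<in> S" if y: "y \<in> carrier G" for y r s
  proof -
    obtain v where "v \<in> fp_words ?I C" "y = fp_rel ?I C `` {v}"
      by (rule fp_carrierE[OF grp y[unfolded G_def]])
    then show ?thesis using hw ent_word by simp
  qed
  obtain i where i: "i \<in> ?I" "sin (\<Theta> i) \<noteq> 0" using ntriv by blast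
  have one: "1 \<in> carrier (C i)" using Pge[OF i(1)] Ccar[OF i(1)] by simp
  have nt: "h (fp_incl ?I C i 1) \<noteq> mat 1"
  proof
    assume "h (fp_incl ?I C i 1) = mat 1"
    then have "qrep (rot (\<Theta> i) (U i)) = mat 1"
      unfolding hf[OF i(1) one] by (simp add: f_def)
    then have "imag_part (rot (\<Theta> i) (U i)) = 0" by (rule qrep_eq_one_imp_real)
    then have "U i = (0, 0)" using i(2) by (simp add: imag_part_def rot_def zero_prod_def prod_eq_iff)
    then show False using U[of i] by (simp add: norm_Pair)
  qed
  obtain N where N: "N \<in> proper_normal_finite_index_subgroups G" "\<forall>x\<in>carrier G. h x = mat 1 \<longrightarrow> x \<in> N"
    using linear_group_finite_quotient[OF G h1 hm S(1,3) ent incl_car[OF i(1) one] nt] by blast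
  have "h x = mat 1"
    using hw[OF u(1)] qrep_real[OF norm_qword[OF U] ux] by (simp add: u(2))
  then show ?thesis using N x by blast
qed

lemma (in comm_group) eq_one_if_coprime_torsion_product_one:
  assumes c: "x \<in> carrier G" "y \<in> carrier G" "z \<in> carrier G" and xyz: "x \<otimes> (y \<otimes> z) = \<one>"
    and o: "x [^] (l::nat) = \<one>" "y [^] (m::nat) = \<one>" "z [^] (n::nat) = \<one>"
    and co: "coprime l m" "coprime l n"
  shows "x = \<one>"
proof -
  have "y [^] (m * n) = \<one>" using nat_pow_pow[OF c(2), of m n] o(2) by simp
  moreover have "z [^] (m * n) = \<one>"
    using nat_pow_pow[OF c(3), of n m] o(3) by (simp add: mult.commute)
  moreover have "(x \<otimes> (y \<otimes> z)) [^] (m * n) = x [^] (m * n) \<otimes> (y [^] (m * n) \<otimes> z [^] (m * n))"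
    using c by (simp add: nat_pow_distrib)
  ultimately have "x [^] (m * n) = \<one>" using xyz c by simp
  then have "ord x dvd m * n" "ord x dvd l" using o(1) c by (simp_all add: pow_eq_id)
  moreover have "coprime l (m * n)" using co by simp
  ultimately have "ord x = 1" using coprime_common_divisor_nat by blast
  then show ?thesis using c(1) pow_eq_id[of x 1] by simp
qed

text \<open>In an abelian quotient in which the product of the three generators is trivial, each generator is the
inverse of a product whose order is prime to its own, so all of them are trivial.\<close>

lemma free_product_normally_generated_mod_derived:
  fixes P :: "nat \<Rightarrow> nat" and G (structure)
  defines "C \<equiv> \<lambda>i. integer_mod_group (P i)"
  defines "G \<equiv> free_product {0, 1, 2} C"
  defines "g \<equiv> fp_incl {0, 1, 2} C 0 1 \<otimes>\<^bsub>G\<^esub> fp_incl {0, 1, 2} C 1 1 \<otimes>\<^bsub>G\<^esub> fp_incl {0, 1, 2} C 2 1"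
  assumes P: "\<And>i. i \<in> {0,1,2} \<Longrightarrow> prime (P i)" and dist: "P 0 \<noteq> P 1" "P 0 \<noteq> P 2" "P 1 \<noteq> P 2"
  shows "g \<in> carrier G"
    and "N \<lhd> G \<Longrightarrow> derived G (carrier G) \<subseteq> N \<Longrightarrow> g \<in> N \<Longrightarrow> N = carrier G"
proof -
  let ?I = "{0, 1, 2} :: nat set"
  have grp: "group (C i)" if "i \<in> ?I" for i by (simp add: C_def)
  have Pge: "P i \<ge> 2" if "i \<in> ?I" for i using P[OF that] by (rule prime_ge_2_nat)
  have Ccar: "carrier (C i) = {0..<int (P i)}" if "i \<in> ?I" for i
    using Pge[OF that] by (simp add: C_def carrier_integer_mod_group)
  have one: "1 \<in> carrier (C i)" if "i \<in> ?I" for i using Pge[OF that] Ccar[OF that] by simp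
  have G: "group G" unfolding G_def by (rule group_free_product[OF grp])
  interpret group G by (rule G)
  have incl: "fp_incl ?I C i \<in> hom (C i) G" if "i \<in> ?I" for i
    unfolding G_def by (rule fp_incl_hom[OF grp that])
  define a where "a i = fp_incl ?I C i 1" for i
  have ac: "a i \<in> carrier G" if "i \<in> ?I" for i
    unfolding a_def by (rule hom_in_carrier[OF incl[OF that] one[OF that]])
  have ga: "g = a 0 \<otimes> a 1 \<otimes> a 2" by (simp add: g_def a_def)
  show gc: "g \<in> carrier G" using ac by (simp add: ga)
  have pow: "a i [^] n = fp_incl ?I C i (int n mod int (P i))" if i: "i \<in> ?I" for i and n :: nat
  proof -
    interpret h: group_hom "C i" G "fp_incl ?I C i"
      using grp[OF i] G incl[OF i] by (simp add: group_hom_def group_hom_axioms_def)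
    have "fp_incl ?I C i (1 [^]\<^bsub>C i\<^esub> n) = a i [^] n"
      unfolding a_def by (rule h.hom_nat_pow[OF one[OF i]])
    then show ?thesis by (simp add: C_def)
  qed
  assume N: "N \<lhd> G" and D: "derived G (carrier G) \<subseteq> N" and gN: "g \<in> N"
  interpret N: normal N G by (rule N)
  interpret Q: comm_group "G Mod N"
  proof (rule group.group_comm_groupI[OF N.factorgroup_is_group])
    fix X Y assume "X \<in> carrier (G Mod N)" "Y \<in> carrier (G Mod N)"
    then obtain x y where x: "x \<in> carrier G" "X = N #> x" and y: "y \<in> carrier G" "Y = N #> y"
      by (auto simp: FactGroup_def RCOSETS_def)
    have "x \<otimes> y \<otimes> inv x \<otimes> inv y \<in> derived_set G (carrier G)" using x(1) y(1) by blast
    then have "x \<otimes> y \<otimes> inv x \<otimes> inv y \<in> N"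
      using D unfolding derived_def by (blast intro: generate.incl)
    then have "N #> (x \<otimes> y) = N #> (y \<otimes> x)"
      using x y by (simp add: rcos_eq_iff[OF N] inv_mult_group m_assoc)
    then show "X \<otimes>\<^bsub>G Mod N\<^esub> Y = Y \<otimes>\<^bsub>G Mod N\<^esub> X"
      using x y by (simp add: FactGroup_def N.rcos_sum)
  qed
  interpret pi: group_hom G "G Mod N" "\<lambda>x. N #> x"
    using N.r_coset_hom_Mod N.factorgroup_is_group G by (simp add: group_hom_def group_hom_axioms_def)
  define b where "b i = N #> a i" for i
  have bc: "b i \<in> carrier (G Mod N)" if "i \<in> ?I" for i unfolding b_def using ac[OF that] by (rule pi.hom_closed)
  have bP: "b i [^]\<^bsub>G Mod N\<^esub> P i = \<one>\<^bsub>G Mod N\<^esub>" if i: "i \<in> ?I" for i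
  proof -
    have "a i [^] P i = fp_incl ?I C i \<one>\<^bsub>C i\<^esub>" using pow[OF i, of "P i"] by (simp add: C_def)
    also have "\<dots> = \<one>" by (rule hom_one[OF incl[OF i] grp[OF i] G])
    finally show ?thesis unfolding b_def using pi.hom_nat_pow[OF ac[OF i], of "P i"] pi.hom_one by simp
  qed
  have prod: "b 0 \<otimes>\<^bsub>G Mod N\<^esub> b 1 \<otimes>\<^bsub>G Mod N\<^esub> b 2 = \<one>\<^bsub>G Mod N\<^esub>"
  proof -
    have "N #> g = N" using gN gc by (simp add: coset_join2 N.subgroup_axioms)
    moreover have "N #> g = b 0 \<otimes>\<^bsub>G Mod N\<^esub> b 1 \<otimes>\<^bsub>G Mod N\<^esub> b 2"
      unfolding b_def ga using ac by (simp only: pi.hom_mult m_closed insertI1 insertI2)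
    ultimately show ?thesis by (simp add: FactGroup_def)
  qed
  have co: "coprime (P 0) (P 1)" "coprime (P 0) (P 2)" "coprime (P 1) (P 2)"
    using P dist by (auto intro!: primes_coprime)
  have b012: "b 0 \<in> carrier (G Mod N)" "b 1 \<in> carrier (G Mod N)" "b 2 \<in> carrier (G Mod N)"
    by (auto intro!: bc simp del: One_nat_def)
  have P012: "b 0 [^]\<^bsub>G Mod N\<^esub> P 0 = \<one>\<^bsub>G Mod N\<^esub>" "b 1 [^]\<^bsub>G Mod N\<^esub> P 1 = \<one>\<^bsub>G Mod N\<^esub>"
    "b 2 [^]\<^bsub>G Mod N\<^esub> P 2 = \<one>\<^bsub>G Mod N\<^esub>"
    by (rule bP; simp)+
  have e0: "b 0 \<otimes>\<^bsub>G Mod N\<^esub> (b 1 \<otimes>\<^bsub>G Mod N\<^esub> b 2) = \<one>\<^bsub>G Mod N\<^esub>"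
    using prod Q.m_assoc[OF b012] by argo
  have e1: "b 1 \<otimes>\<^bsub>G Mod N\<^esub> (b 0 \<otimes>\<^bsub>G Mod N\<^esub> b 2) = \<one>\<^bsub>G Mod N\<^esub>"
    using e0 Q.m_lcomm[OF b012(2,1,3)] by argo
  have e2: "b 2 \<otimes>\<^bsub>G Mod N\<^esub> (b 0 \<otimes>\<^bsub>G Mod N\<^esub> b 1) = \<one>\<^bsub>G Mod N\<^esub>"
    using prod Q.m_comm[OF b012(3) Q.m_closed[OF b012(1,2)]] by argo
  have b_all: "b i = \<one>\<^bsub>G Mod N\<^esub>" if "i \<in> ?I" for i
  proof -
    have "b 0 = \<one>\<^bsub>G Mod N\<^esub>"
      by (rule Q.eq_one_if_coprime_torsion_product_one[OF b012 e0 P012 co(1,2)])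
    moreover have "b 1 = \<one>\<^bsub>G Mod N\<^esub>"
      by (rule Q.eq_one_if_coprime_torsion_product_one[OF b012(2,1,3) e1 P012(2,1,3)])
        (use co in \<open>simp_all add: coprime_commute\<close>)
    moreover have "b 2 = \<one>\<^bsub>G Mod N\<^esub>"
      by (rule Q.eq_one_if_coprime_torsion_product_one[OF b012(3,1,2) e2 P012(3,1,2)])
        (use co in \<open>simp_all add: coprime_commute\<close>)
    ultimately show ?thesis using that by auto
  qed
  have aN: "a i \<in> N" if "i \<in> ?I" for i
    using b_all[OF that] ac[OF that] rcos_self[OF ac[OF that] N.subgroup_axioms]
    by (simp add: b_def FactGroup_def)
  have inclN: "fp_incl ?I C i n \<in> N" if "i \<in> ?I" "n \<in> carrier (C i)" for i n
  proof -
    have "a i [^] k \<in> N" for k :: nat by (induction k) (use aN[OF that(1)] in auto)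
    moreover have "int (nat n) mod int (P i) = n" using that Ccar[OF that(1)] by simp
    ultimately show ?thesis using pow[OF that(1), of "nat n"] by metis
  qed
  have "fp_rel ?I C `` {v} \<in> N" if "v \<in> fp_words ?I C" for v
    using that
  proof (induction v)
    case Nil
    then show ?case using N.one_closed by (simp add: G_def free_product_def)
  next
    case (Cons l v)
    obtain i n where l: "l = (i, n)" by force
    have ia: "i \<in> ?I" "n \<in> carrier (C i)" "v \<in> fp_words ?I C" using Cons.prems l by auto
    have "fp_rel ?I C `` {l # v} = fp_incl ?I C i n \<otimes> (fp_rel ?I C `` {v})"
      unfolding fp_incl_def G_def l using fp_mult[of ?I C "[(i, n)]" v, OF grp] ia by simp
    then show ?case using Cons.IH ia inclN by auto
  qed
  moreover have "\<exists>v\<in>fp_words ?I C. x = fp_rel ?I C `` {v}" if "x \<in> carrier G" for x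
    using that by (auto simp: G_def free_product_def elim: quotientE)
  ultimately have "carrier G \<subseteq> N" by blast
  then show "N = carrier G" using N.subset by blast
qed


theorem theorem5p15:
  fixes p q r :: nat
    and G :: "(nat \<times> int) list set monoid"
  assumes "prime p" and "prime q" and "prime r"
    and "p \<noteq> q" and "p \<noteq> r" and "q \<noteq> r"
  defines "G \<equiv> free_product {0, 1, 2} (\<lambda>i. integer_mod_group ([p, q, r] ! i))"
  shows "infinite (proper_normal_finite_index_subgroups G)
    \<and> carrier G = \<Union> (proper_normal_finite_index_subgroups G)
    \<and> \<not> (\<exists>F. finite F \<and> F \<subseteq> proper_normal_finite_index_subgroups G \<and> carrier G = \<Union> F)"
proof -
  let ?P = "\<lambda>i. [p, q, r] ! i" and ?S = "proper_normal_finite_index_subgroups G"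
  have P: "prime (?P i)" if "i \<in> {0, 1, 2}" for i using that assms(1-3) by auto
  have dist: "?P 0 \<noteq> ?P 1" "?P 0 \<noteq> ?P 2" "?P 1 \<noteq> ?P 2" using assms(4-6) by auto
  have G: "group G" unfolding G_def by (rule group_free_product) simp
  have cover: "carrier G = \<Union> ?S"
  proof
    show "carrier G \<subseteq> \<Union> ?S"
      using free_product_elem_in_proper_normal[of ?P, OF P dist] unfolding G_def by blast
    show "\<Union> ?S \<subseteq> carrier G"
      unfolding proper_normal_finite_index_subgroups_def
      using normal_imp_subgroup subgroup.subset by fastforce
  qed
  have no_finite: "carrier G \<noteq> \<Union> F" if "finite F" "F \<subseteq> ?S" for F
    by (rule group.not_finite_union_of_proper_normal[OF G
          free_product_normally_generated_mod_derived[of ?P, OF P dist, folded G_def] that])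
  have "infinite ?S"
  proof
    assume "finite ?S"
    from no_finite[OF this subset_refl] cover show False by contradiction
  qed
  moreover have "\<not> (\<exists>F. finite F \<and> F \<subseteq> ?S \<and> carrier G = \<Union> F)"
    using no_finite by metis
  ultimately show ?thesis using cover by (intro conjI)
qed

end
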